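(* Let $n \ge 1$, $U \subseteq \mathbb{Z}_3^n$ and $i \in [n]$. If $U$ is $i$-saturated and the subgraph of $H(n,3)$ induced by $U$ has maximum degree at most $1$, then $|U| \le 3^{n-1}+81$.
   Context: $H(n,3)$ is the Hamming graph: its vertex set is $\mathbb{Z}_3^n$ and two vertices are adjacent if and only if they differ in exactly one coordinate. $e_1,\dots,e_n$ is the standard basis of $\mathbb{Z}_3^n$. A set $U \subseteq \mathbb{Z}_3^n$ is $i$-saturated if $U \cap \{x, x+e_i, x+2e_i\} \neq \emptyset$ for every $x \in \mathbb{Z}_3^n$, i.e., every line in direction $e_i$ contains a point of $U$. *)

theory Defs
  imports
    "HOL-Analysis.Finite_Cartesian_Product"
    "HOL-Library.Numeral_Type"
    "Graph_Theory.Graph_Theory"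
begin

text \<open>
  The numeral type \<open>3\<close> carries arithmetic modulo 3, so \<open>3 ^ 'n\<close> with \<open>n = CARD('n) \<ge> 1\<close> is the
  group \<open>\<int>\<^sub>3\<^sup>n\<close>, and \<open>axis i 1\<close> is the standard basis vector \<open>e\<^sub>i\<close>.
\<close>

definition hamming_graph3 :: "(3 ^ 'n::finite) pair_pre_digraph" where
  "hamming_graph3 = \<lparr>pverts = UNIV, parcs = {(x, y). \<exists>!j. x $ j \<noteq> y $ j}\<rparr>"

text \<open>An undirected simple graph is represented by a loop-free symmetric digraph:\<close>

lemma pair_graph_hamming_graph3: "pair_graph (hamming_graph3 :: (3 ^ 'n::finite) pair_pre_digraph)"
proof -
  have "finite (parcs (hamming_graph3 :: (3 ^ 'n) pair_pre_digraph))"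
    by (rule finite_subset[OF subset_UNIV]) simp
  then show ?thesis
    by unfold_locales
      (auto simp: hamming_graph3_def symmetric_def sym_def eq_commute)
qed

text \<open>
  For symmetric digraphs the degree of a vertex is its out-degree. The value is meaningful only for
  finite graphs with at least one vertex.
\<close>

definition max_degree :: "('a, 'b) pre_digraph \<Rightarrow> nat" where
  "max_degree G = Max (out_degree G ` verts G)"

definition saturated :: "'n \<Rightarrow> (3 ^ 'n::finite) set \<Rightarrow> bool" where
  "saturated i U \<longleftrightarrow> (\<forall>x. U \<inter> {x, x + axis i 1, x + 2 *s axis i 1} \<noteq> {})"

end

theory Submission
  imports Defs
begin

text \<open>
  Call the set of all \<open>e\<close> with \<open>x + e e\<^sub>i \<in> U\<close> the colours of \<open>x\<close>. Every point has one or two colours,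
  so \<open>|U| = 3\<^bsup>n - 1\<^esup> + |D|\<close>, where \<open>D\<close> consists of the lines in direction \<open>i\<close> with two colours, each of
  them represented by its missing point. Around a point of \<open>D\<close> all neighbours have the missing
  colour, and the colours at distance two show that any two directions \<open>j\<close>, \<open>k\<close> are either comparable
  (the colour depends on the coordinate of one of them only) or parallel (it depends on the product of
  both coordinates). Comparability is a forest order, and an analysis of at most four
  directions at a time shows that, apart from the directions that are comparable with all others,
  either there are at most four directions or all of them are pairwise parallel; in the latter case
  the signs of the products colour triangles without a coherent quadruple, and \<open>R(3,3) = 6\<close> leaves
  at most six directions.

  If \<open>j\<close> is comparable with all other directions at one point of \<open>D\<close>, then no line in direction \<open>j\<close>
  carries the three colours in the reversed order; hence \<open>j\<close> is comparable with all other directions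
  at every point of \<open>D\<close>. Moving along such directions preserves the local picture, so the
  projection of \<open>D\<close> to the remaining at most six directions is injective and has minimum distance 3.
  By the Singleton bound \<open>|D| \<le> 3\<^sup>4\<close>.
\<close>

declare [[smt_timeout = 600]]

section \<open>Arithmetic modulo 3\<close>

lemma UNIV_3: "(UNIV :: 3 set) = {0, 1, 2}"
proof -
  have "card {0, 1, 2 :: 3} = 3"
    by simp
  then have "{0, 1, 2 :: 3} = UNIV"
    by (intro card_subset_eq) simp_all
  then show ?thesis ..
qed

lemma all_3: "(\<forall>x::3. P x) \<longleftrightarrow> P 0 \<and> P 1 \<and> P 2"
  using UNIV_3 by (metis UNIV_I empty_iff insert_iff)

lemma ex_3: "(\<exists>x::3. P x) \<longleftrightarrow> P 0 \<or> P 1 \<or> P 2"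
  using all_3[of "\<lambda>x. \<not> P x"] by blast

lemma cases_3: "x = 0 \<or> x = 1 \<or> x = (2 :: 3)"
  using UNIV_3 by blast

lemma distinct_3: "(0::3) \<noteq> 1" "(0::3) \<noteq> 2" "(1::3) \<noteq> 2"
  by simp_all

lemma minus_3: "- (1::3) = 2" "- (2::3) = 1"
  by simp_all

lemma add_3: "(3::3) = 0" "(4::3) = 1"
  by simp_all

text \<open>The units are 1 and -1, so every sign is its own inverse; each rescaling by a sign below
  therefore undoes itself.\<close>

lemma square_3: "k \<noteq> 0 \<Longrightarrow> k * k = (1 :: 3)"
  using all_3[of "\<lambda>k. k \<noteq> 0 \<longrightarrow> k * k = 1"] by simp

lemma scale_eq_3: "k \<noteq> 0 \<Longrightarrow> k * x = k * y \<longleftrightarrow> x = (y :: 3)"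
  by (metis square_3 mult.assoc mult_1)

lemma affine_3: "k \<noteq> 0 \<Longrightarrow> r + k * x = r + k * y \<longleftrightarrow> x = (y :: 3)"
  by (simp add: scale_eq_3)

lemma affine_surj_3: "k \<noteq> 0 \<Longrightarrow> \<exists>x. r + k * x = (y :: 3)"
  using square_3[of k] by (intro exI[of _ "k * (y - r)"]) (simp add: mult.assoc[symmetric])

lemma scale_eq_0_3 [simp]: "k \<noteq> 0 \<Longrightarrow> k * x = 0 \<longleftrightarrow> x = (0 :: 3)"
  using scale_eq_3[of k x 0] by simp

lemma scale_scale_3 [simp]: "k \<noteq> 0 \<Longrightarrow> k * (k * x) = (x :: 3)"
  using square_3[of k] by (simp add: mult.assoc[symmetric])

section \<open>Small grids\<close>

text \<open>
  In the following locales \<open>u\<close> describes the restriction of \<open>U\<close> to an affine subspace; the last argument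
  is the coordinate in direction \<open>i\<close>. The assumptions \<open>lines\<close> and \<open>cross\<close> say that no point of \<open>U\<close> has two
  neighbours in \<open>U\<close>.
\<close>

locale grid3 =
  fixes u :: "3 \<Rightarrow> 3 \<Rightarrow> 3 \<Rightarrow> bool"
  assumes total: "u a b 0 \<or> u a b 1 \<or> u a b 2"
    and lines:
      "u a b e \<Longrightarrow> u a' b e \<Longrightarrow> u a'' b e \<Longrightarrow> a = a' \<or> a = a'' \<or> a' = a''"
      "u a b e \<Longrightarrow> u a b' e \<Longrightarrow> u a b'' e \<Longrightarrow> b = b' \<or> b = b'' \<or> b' = b''"
      "u a b e \<Longrightarrow> u a b e' \<Longrightarrow> u a b e'' \<Longrightarrow> e = e' \<or> e = e'' \<or> e' = e''"
    and cross:
      "u a b e \<Longrightarrow> u a' b e \<Longrightarrow> u a b' e \<Longrightarrow> a = a' \<or> b = b'"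
      "u a b e \<Longrightarrow> u a' b e \<Longrightarrow> u a b e' \<Longrightarrow> a = a' \<or> e = e'"
      "u a b e \<Longrightarrow> u a b' e \<Longrightarrow> u a b e' \<Longrightarrow> b = b' \<or> e = e'"
begin

lemmas rules = total lines cross distinct_3

end

locale grid4 =
  fixes u :: "3 \<Rightarrow> 3 \<Rightarrow> 3 \<Rightarrow> 3 \<Rightarrow> bool"
  assumes total: "u a b c 0 \<or> u a b c 1 \<or> u a b c 2"
    and lines:
      "u a b c e \<Longrightarrow> u a' b c e \<Longrightarrow> u a'' b c e \<Longrightarrow> a = a' \<or> a = a'' \<or> a' = a''"
      "u a b c e \<Longrightarrow> u a b' c e \<Longrightarrow> u a b'' c e \<Longrightarrow> b = b' \<or> b = b'' \<or> b' = b''"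
      "u a b c e \<Longrightarrow> u a b c' e \<Longrightarrow> u a b c'' e \<Longrightarrow> c = c' \<or> c = c'' \<or> c' = c''"
      "u a b c e \<Longrightarrow> u a b c e' \<Longrightarrow> u a b c e'' \<Longrightarrow> e = e' \<or> e = e'' \<or> e' = e''"
    and cross:
      "u a b c e \<Longrightarrow> u a' b c e \<Longrightarrow> u a b' c e \<Longrightarrow> a = a' \<or> b = b'"
      "u a b c e \<Longrightarrow> u a' b c e \<Longrightarrow> u a b c' e \<Longrightarrow> a = a' \<or> c = c'"
      "u a b c e \<Longrightarrow> u a' b c e \<Longrightarrow> u a b c e' \<Longrightarrow> a = a' \<or> e = e'"
      "u a b c e \<Longrightarrow> u a b' c e \<Longrightarrow> u a b c' e \<Longrightarrow> b = b' \<or> c = c'"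
      "u a b c e \<Longrightarrow> u a b' c e \<Longrightarrow> u a b c e' \<Longrightarrow> b = b' \<or> e = e'"
      "u a b c e \<Longrightarrow> u a b c' e \<Longrightarrow> u a b c e' \<Longrightarrow> c = c' \<or> e = e'"
begin

lemmas rules = total lines cross distinct_3

end

locale grid5 =
  fixes u :: "3 \<Rightarrow> 3 \<Rightarrow> 3 \<Rightarrow> 3 \<Rightarrow> 3 \<Rightarrow> bool"
  assumes total: "u a b c d 0 \<or> u a b c d 1 \<or> u a b c d 2"
    and lines:
      "u a b c d e \<Longrightarrow> u a' b c d e \<Longrightarrow> u a'' b c d e \<Longrightarrow> a = a' \<or> a = a'' \<or> a' = a''"
      "u a b c d e \<Longrightarrow> u a b' c d e \<Longrightarrow> u a b'' c d e \<Longrightarrow> b = b' \<or> b = b'' \<or> b' = b''"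
      "u a b c d e \<Longrightarrow> u a b c' d e \<Longrightarrow> u a b c'' d e \<Longrightarrow> c = c' \<or> c = c'' \<or> c' = c''"
      "u a b c d e \<Longrightarrow> u a b c d' e \<Longrightarrow> u a b c d'' e \<Longrightarrow> d = d' \<or> d = d'' \<or> d' = d''"
      "u a b c d e \<Longrightarrow> u a b c d e' \<Longrightarrow> u a b c d e'' \<Longrightarrow> e = e' \<or> e = e'' \<or> e' = e''"
    and cross:
      "u a b c d e \<Longrightarrow> u a' b c d e \<Longrightarrow> u a b' c d e \<Longrightarrow> a = a' \<or> b = b'"
      "u a b c d e \<Longrightarrow> u a' b c d e \<Longrightarrow> u a b c' d e \<Longrightarrow> a = a' \<or> c = c'"
      "u a b c d e \<Longrightarrow> u a' b c d e \<Longrightarrow> u a b c d' e \<Longrightarrow> a = a' \<or> d = d'"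
      "u a b c d e \<Longrightarrow> u a' b c d e \<Longrightarrow> u a b c d e' \<Longrightarrow> a = a' \<or> e = e'"
      "u a b c d e \<Longrightarrow> u a b' c d e \<Longrightarrow> u a b c' d e \<Longrightarrow> b = b' \<or> c = c'"
      "u a b c d e \<Longrightarrow> u a b' c d e \<Longrightarrow> u a b c d' e \<Longrightarrow> b = b' \<or> d = d'"
      "u a b c d e \<Longrightarrow> u a b' c d e \<Longrightarrow> u a b c d e' \<Longrightarrow> b = b' \<or> e = e'"
      "u a b c d e \<Longrightarrow> u a b c' d e \<Longrightarrow> u a b c d' e \<Longrightarrow> c = c' \<or> d = d'"
      "u a b c d e \<Longrightarrow> u a b c' d e \<Longrightarrow> u a b c d e' \<Longrightarrow> c = c' \<or> e = e'"
      "u a b c d e \<Longrightarrow> u a b c d' e \<Longrightarrow> u a b c d e' \<Longrightarrow> d = d' \<or> e = e'"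
begin

lemmas rules = total lines cross distinct_3

end

section \<open>Local analysis around a point with monochromatic neighbours\<close>

text \<open>The two points of colour 0 on an axis are mates, which excludes colour 0 off the axes;
  carrying both colours 1 and 2 at one point would create a second mate next to it. So the four
  points off the axes form a 4-cycle with colours 1 and 2 on which no point agrees with both
  neighbours. This leaves six patterns: three shapes times the sign \<open>s\<close>.\<close>

lemma (in grid3) hub_plane:
  assumes hub: "\<forall>a e. a \<noteq> 0 \<longrightarrow> (u a 0 e \<longleftrightarrow> e = 0)" "\<forall>b e. b \<noteq> 0 \<longrightarrow> (u 0 b e \<longleftrightarrow> e = 0)"
  shows "\<exists>s. s \<noteq> 0 \<and> ((\<forall>a b e. a \<noteq> 0 \<longrightarrow> b \<noteq> 0 \<longrightarrow> (u a b e \<longleftrightarrow> e = s * a)) \<or>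
    (\<forall>a b e. a \<noteq> 0 \<longrightarrow> b \<noteq> 0 \<longrightarrow> (u a b e \<longleftrightarrow> e = s * b)) \<or>
    (\<forall>a b e. a \<noteq> 0 \<longrightarrow> b \<noteq> 0 \<longrightarrow> (u a b e \<longleftrightarrow> e = s * a * b)))"
proof -
  note ground = hub[unfolded all_3, simplified]
  have "(\<not> u a b 0) \<and> (u a b 1 \<longleftrightarrow> \<not> u a b 2)" if "a \<noteq> 0" "b \<noteq> 0" for a b
    using ground rules that by (smt (z3))
  note w = this[of 1 1, simplified] this[of 1 2, simplified] this[of 2 1, simplified] this[of 2 2, simplified]
  have "u 1 1 1 = u 1 2 1 \<and> u 2 1 1 = u 2 2 1 \<and> u 1 1 1 \<noteq> u 2 1 1 \<or>
    u 1 1 1 = u 2 1 1 \<and> u 1 2 1 = u 2 2 1 \<and> u 1 1 1 \<noteq> u 1 2 1 \<or>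
    u 1 1 1 = u 2 2 1 \<and> u 1 2 1 = u 2 1 1 \<and> u 1 1 1 \<noteq> u 1 2 1"
    using ground w rules by (smt (z3))
  then show ?thesis
    unfolding all_3 ex_3 using w by simp blast
qed

text \<open>Off the coordinate planes the colours \<open>a\<close>, \<open>b\<close> and
  \<open>c\<close> are excluded at \<open>(a, b, c)\<close>, because the projections to the planes
  already have mates. The six nonconstant points then have colour 0 only, but they form a
  6-cycle.\<close>

lemma (in grid4) no_cycle:
  assumes hub: "\<forall>a e. a \<noteq> 0 \<longrightarrow> (u a 0 0 e \<longleftrightarrow> e = 0)"
      "\<forall>b e. b \<noteq> 0 \<longrightarrow> (u 0 b 0 e \<longleftrightarrow> e = 0)" "\<forall>c e. c \<noteq> 0 \<longrightarrow> (u 0 0 c e \<longleftrightarrow> e = 0)"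
    and w: "\<forall>a b e. a \<noteq> 0 \<longrightarrow> b \<noteq> 0 \<longrightarrow> (u a b 0 e \<longleftrightarrow> e = a)"
      "\<forall>b c e. b \<noteq> 0 \<longrightarrow> c \<noteq> 0 \<longrightarrow> (u 0 b c e \<longleftrightarrow> e = b)"
      "\<forall>a c e. a \<noteq> 0 \<longrightarrow> c \<noteq> 0 \<longrightarrow> (u a 0 c e \<longleftrightarrow> e = c)"
  shows False
  using hub[unfolded all_3, simplified] w[unfolded all_3, simplified] rules by (smt (z3))

text \<open>The first two dominances alone force colour \<open>a + b\<close> at
  \<open>(a, b, c)\<close>, with mates along the third direction (as in
  \<open>chain_colour\<close>). But \<open>(1, 0, 2)\<close> has colour 2 and would be a second
  neighbour of \<open>(1, 1, 2)\<close>.\<close>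

lemma (in grid4) no_chain_par:
  assumes hub: "\<forall>a e. a \<noteq> 0 \<longrightarrow> (u a 0 0 e \<longleftrightarrow> e = 0)"
      "\<forall>b e. b \<noteq> 0 \<longrightarrow> (u 0 b 0 e \<longleftrightarrow> e = 0)" "\<forall>c e. c \<noteq> 0 \<longrightarrow> (u 0 0 c e \<longleftrightarrow> e = 0)"
    and w: "\<forall>a b e. a \<noteq> 0 \<longrightarrow> b \<noteq> 0 \<longrightarrow> (u a b 0 e \<longleftrightarrow> e = a)"
      "\<forall>b c e. b \<noteq> 0 \<longrightarrow> c \<noteq> 0 \<longrightarrow> (u 0 b c e \<longleftrightarrow> e = b)"
      "\<forall>a c e. a \<noteq> 0 \<longrightarrow> c \<noteq> 0 \<longrightarrow> (u a 0 c e \<longleftrightarrow> e = a * c)"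
  shows False
  using hub[unfolded all_3, simplified] w[unfolded all_3, simplified] rules by (smt (z3))

text \<open>The two dominances force colour \<open>a + c\<close> at \<open>(a, b, c)\<close>, with
  mates along the second direction, so the colour \<open>q * a * c\<close> of
  \<open>(a, 0, c)\<close> has to differ from \<open>a + c\<close>. This fails at
  \<open>a = c = 2\<close> if \<open>q = 1\<close> and at \<open>a = c = 1\<close> if
  \<open>q = 2\<close>.\<close>

lemma (in grid4) no_fork_par:
  assumes hub: "\<forall>a e. a \<noteq> 0 \<longrightarrow> (u a 0 0 e \<longleftrightarrow> e = 0)"
      "\<forall>b e. b \<noteq> 0 \<longrightarrow> (u 0 b 0 e \<longleftrightarrow> e = 0)" "\<forall>c e. c \<noteq> 0 \<longrightarrow> (u 0 0 c e \<longleftrightarrow> e = 0)"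
    and w: "\<forall>a b e. a \<noteq> 0 \<longrightarrow> b \<noteq> 0 \<longrightarrow> (u a b 0 e \<longleftrightarrow> e = a)"
      "\<forall>b c e. b \<noteq> 0 \<longrightarrow> c \<noteq> 0 \<longrightarrow> (u 0 b c e \<longleftrightarrow> e = c)"
      "\<forall>a c e. a \<noteq> 0 \<longrightarrow> c \<noteq> 0 \<longrightarrow> (u a 0 c e \<longleftrightarrow> e = q * a * c)"
    and q: "q \<noteq> 0"
  shows False
proof -
  have "q = 1 \<or> q = 2"
    using q all_3[of "\<lambda>q. q \<noteq> 0 \<longrightarrow> q = 1 \<or> q = 2"] by simp
  then show False
  proof
    assume "q = 1"
    then show False
      using hub[unfolded all_3, simplified] w[unfolded all_3, simplified] rules by (smt (z3))
  next
    assume "q = 2"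
    then show False
      using hub[unfolded all_3, simplified] w[unfolded all_3 \<open>q = 2\<close>, simplified] rules by (smt (z3))
  qed
qed

text \<open>At \<open>(a, b, c)\<close> the colours \<open>a\<close> and \<open>2 * a\<close> are
  taken by mated pairs in the two planes. All eight points off the planes would have colour 0,
  giving each three neighbours.\<close>

lemma (in grid4) dominance_sign:
  assumes hub: "\<forall>a e. a \<noteq> 0 \<longrightarrow> (u a 0 0 e \<longleftrightarrow> e = 0)"
      "\<forall>b e. b \<noteq> 0 \<longrightarrow> (u 0 b 0 e \<longleftrightarrow> e = 0)" "\<forall>c e. c \<noteq> 0 \<longrightarrow> (u 0 0 c e \<longleftrightarrow> e = 0)"
    and w: "\<forall>a b e. a \<noteq> 0 \<longrightarrow> b \<noteq> 0 \<longrightarrow> (u a b 0 e \<longleftrightarrow> e = a)"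
      "\<forall>a c e. a \<noteq> 0 \<longrightarrow> c \<noteq> 0 \<longrightarrow> (u a 0 c e \<longleftrightarrow> e = 2 * a)"
  shows False
  using hub[unfolded all_3, simplified] w[unfolded all_3, simplified] rules by (smt (z3))

text \<open>The colours \<open>a\<close> and \<open>b\<close> are excluded at
  \<open>(a, b, c)\<close> by mated pairs in the planes. If \<open>a\<close> and \<open>b\<close>
  differ, only 0 is left, and these points are mated along \<open>c\<close>; hence 0 is excluded for
  \<open>a = b\<close>, where \<open>a + a\<close> remains.\<close>

lemma (in grid4) chain_colour:
  assumes hub: "\<forall>a e. a \<noteq> 0 \<longrightarrow> (u a 0 0 e \<longleftrightarrow> e = 0)"
      "\<forall>b e. b \<noteq> 0 \<longrightarrow> (u 0 b 0 e \<longleftrightarrow> e = 0)" "\<forall>c e. c \<noteq> 0 \<longrightarrow> (u 0 0 c e \<longleftrightarrow> e = 0)"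
    and w: "\<forall>a b e. a \<noteq> 0 \<longrightarrow> b \<noteq> 0 \<longrightarrow> (u a b 0 e \<longleftrightarrow> e = a)"
      "\<forall>a c e. a \<noteq> 0 \<longrightarrow> c \<noteq> 0 \<longrightarrow> (u a 0 c e \<longleftrightarrow> e = a)"
      "\<forall>b c e. b \<noteq> 0 \<longrightarrow> c \<noteq> 0 \<longrightarrow> (u 0 b c e \<longleftrightarrow> e = b)"
  shows "\<forall>a b c e. a \<noteq> 0 \<longrightarrow> b \<noteq> 0 \<longrightarrow> c \<noteq> 0 \<longrightarrow> (u a b c e \<longleftrightarrow> e = a + b)"
proof -
  note ground = hub[unfolded all_3, simplified] w[unfolded all_3, simplified]
  have 1: "u 1 2 c 0 \<and> \<not> u 1 2 c 1 \<and> \<not> u 1 2 c 2 \<and> u 2 1 c 0 \<and> \<not> u 2 1 c 1 \<and> \<not> u 2 1 c 2"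
    if "c = 1 \<or> c = 2" for c
    using that ground rules by (smt (z3))
  note g = 1[of 1, simplified] 1[of 2, simplified]
  have 2: "\<not> u 1 1 c 0 \<and> \<not> u 1 1 c 1 \<and> u 1 1 c 2 \<and> \<not> u 2 2 c 0 \<and> u 2 2 c 1 \<and> \<not> u 2 2 c 2"
    if "c = 1 \<or> c = 2" for c
    using that ground g rules by (smt (z3))
  show ?thesis
    unfolding all_3 using g 2[of 1] 2[of 2] by simp
qed

text \<open>The points \<open>(1, 0, 2)\<close> and \<open>(2, 0, 2)\<close> carry these same
  colours, so they have their mates in the dominated direction. Later contradictions arise by
  producing two such mates of one point.\<close>

lemma (in grid4) dominance_par_mates:
  assumes hub: "\<forall>a e. a \<noteq> 0 \<longrightarrow> (u a 0 0 e \<longleftrightarrow> e = 0)"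
      "\<forall>b e. b \<noteq> 0 \<longrightarrow> (u 0 b 0 e \<longleftrightarrow> e = 0)" "\<forall>c e. c \<noteq> 0 \<longrightarrow> (u 0 0 c e \<longleftrightarrow> e = 0)"
    and w: "\<forall>a b e. a \<noteq> 0 \<longrightarrow> b \<noteq> 0 \<longrightarrow> (u a b 0 e \<longleftrightarrow> e = a)"
      "\<forall>a c e. a \<noteq> 0 \<longrightarrow> c \<noteq> 0 \<longrightarrow> (u a 0 c e \<longleftrightarrow> e = a * c)"
      "\<forall>b c e. b \<noteq> 0 \<longrightarrow> c \<noteq> 0 \<longrightarrow> (u 0 b c e \<longleftrightarrow> e = b * c)"
  shows "u 1 2 2 2" "u 2 1 2 1"
  using hub[unfolded all_3, simplified] w[unfolded all_3, simplified] rules by (smt (z3))+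

text \<open>This limits how many directions can be parallel to both members of a dominance. The sign
  \<open>q\<close> cannot be normalised together with the others, so both values are
  checked.\<close>

lemma (in grid5) no_dominance_par_square:
  assumes hub: "\<forall>a e. a \<noteq> 0 \<longrightarrow> (u a 0 0 0 e \<longleftrightarrow> e = 0)" "\<forall>b e. b \<noteq> 0 \<longrightarrow> (u 0 b 0 0 e \<longleftrightarrow> e = 0)"
      "\<forall>c e. c \<noteq> 0 \<longrightarrow> (u 0 0 c 0 e \<longleftrightarrow> e = 0)" "\<forall>d e. d \<noteq> 0 \<longrightarrow> (u 0 0 0 d e \<longleftrightarrow> e = 0)"
    and w: "\<forall>a b e. a \<noteq> 0 \<longrightarrow> b \<noteq> 0 \<longrightarrow> (u a b 0 0 e \<longleftrightarrow> e = a)"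
      "\<forall>a c e. a \<noteq> 0 \<longrightarrow> c \<noteq> 0 \<longrightarrow> (u a 0 c 0 e \<longleftrightarrow> e = a * c)"
      "\<forall>a d e. a \<noteq> 0 \<longrightarrow> d \<noteq> 0 \<longrightarrow> (u a 0 0 d e \<longleftrightarrow> e = a * d)"
      "\<forall>b c e. b \<noteq> 0 \<longrightarrow> c \<noteq> 0 \<longrightarrow> (u 0 b c 0 e \<longleftrightarrow> e = b * c)"
      "\<forall>b d e. b \<noteq> 0 \<longrightarrow> d \<noteq> 0 \<longrightarrow> (u 0 b 0 d e \<longleftrightarrow> e = b * d)"
      "\<forall>c d e. c \<noteq> 0 \<longrightarrow> d \<noteq> 0 \<longrightarrow> (u 0 0 c d e \<longleftrightarrow> e = q * c * d)"
    and q: "q \<noteq> 0"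
  shows False
proof -
  have "q = 1 \<or> q = 2"
    using q all_3[of "\<lambda>q. q \<noteq> 0 \<longrightarrow> q = 1 \<or> q = 2"] by simp
  then show False
  proof
    assume "q = 1"
    then show False
      using hub[unfolded all_3, simplified] w[unfolded all_3, simplified] rules by (smt (z3))
  next
    assume "q = 2"
    then show False
      using hub[unfolded all_3, simplified] w[unfolded all_3 \<open>q = 2\<close>, simplified] rules by (smt (z3))
  qed
qed

text \<open>The normal form of four pairwise parallel directions whose triangles all have the same
  sign product.\<close>

lemma (in grid5) no_coherent_par_square:
  assumes hub: "\<forall>a e. a \<noteq> 0 \<longrightarrow> (u a 0 0 0 e \<longleftrightarrow> e = 0)" "\<forall>b e. b \<noteq> 0 \<longrightarrow> (u 0 b 0 0 e \<longleftrightarrow> e = 0)"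
      "\<forall>c e. c \<noteq> 0 \<longrightarrow> (u 0 0 c 0 e \<longleftrightarrow> e = 0)" "\<forall>d e. d \<noteq> 0 \<longrightarrow> (u 0 0 0 d e \<longleftrightarrow> e = 0)"
    and w: "\<forall>a b e. a \<noteq> 0 \<longrightarrow> b \<noteq> 0 \<longrightarrow> (u a b 0 0 e \<longleftrightarrow> e = a * b)"
      "\<forall>a c e. a \<noteq> 0 \<longrightarrow> c \<noteq> 0 \<longrightarrow> (u a 0 c 0 e \<longleftrightarrow> e = a * c)"
      "\<forall>a d e. a \<noteq> 0 \<longrightarrow> d \<noteq> 0 \<longrightarrow> (u a 0 0 d e \<longleftrightarrow> e = a * d)"
      "\<forall>b c e. b \<noteq> 0 \<longrightarrow> c \<noteq> 0 \<longrightarrow> (u 0 b c 0 e \<longleftrightarrow> e = b * c)"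
      "\<forall>b d e. b \<noteq> 0 \<longrightarrow> d \<noteq> 0 \<longrightarrow> (u 0 b 0 d e \<longleftrightarrow> e = b * d)"
      "\<forall>c d e. c \<noteq> 0 \<longrightarrow> d \<noteq> 0 \<longrightarrow> (u 0 0 c d e \<longleftrightarrow> e = c * d)"
  shows False
  using hub[unfolded all_3, simplified] w[unfolded all_3, simplified] rules by (smt (z3))

section \<open>Lines of reversed orientation\<close>

text \<open>The lines \<open>t \<mapsto> r - t\<close>, as opposed to the lines \<open>t \<mapsto> r + t\<close> along a dominating direction.\<close>

definition reversed :: "(3 \<Rightarrow> 3 \<Rightarrow> bool) \<Rightarrow> bool" where
  "reversed f \<longleftrightarrow> (\<exists>r. \<forall>t. f t (r - t))"

lemma reversed_iff:
  "reversed f \<longleftrightarrow> f 0 0 \<and> f 1 2 \<and> f 2 1 \<or> f 0 1 \<and> f 1 0 \<and> f 2 2 \<or> f 0 2 \<and> f 1 1 \<and> f 2 0"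
  by (simp add: reversed_def all_3 ex_3 minus_3)

text \<open>
  A reversed line through the origin, in direction \<open>t\<close>. In the induction on the Hamming distance to a
  base point, the coordinate value 2 decreases the distance. The predicate \<open>mate1\<close> tells which points of
  the line have their neighbour in the first direction.
\<close>

locale reversed_plane = grid4 +
  assumes origin: "\<forall>t e. u 0 0 t e \<longleftrightarrow> e = - t"
    and not_reversed: "\<forall>a b. a = 2 \<or> b = 2 \<longrightarrow> \<not> reversed (u a b)"
begin

definition mate1 :: "3 \<Rightarrow> bool" where
  "mate1 t \<longleftrightarrow> u 1 0 t (- t) \<or> u 2 0 t (- t)"

definition mate2 :: "3 \<Rightarrow> bool" where
  "mate2 t \<longleftrightarrow> u 0 1 t (- t) \<or> u 0 2 t (- t)"

lemmas ground = origin[unfolded all_3, simplified minus_3 minus_zero simp_thms distinct_3 distinct_3[symmetric]]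
  not_reversed[unfolded all_3 reversed_iff, simplified]

lemma mate1_iff:
  "mate1 0 \<longleftrightarrow> u 1 0 0 0 \<or> u 2 0 0 0" "mate1 1 \<longleftrightarrow> u 1 0 1 2 \<or> u 2 0 1 2" "mate1 2 \<longleftrightarrow> u 1 0 2 1 \<or> u 2 0 2 1"
  by (simp_all add: mate1_def minus_3)

lemma mate2_iff:
  "mate2 0 \<longleftrightarrow> u 0 1 0 0 \<or> u 0 2 0 0" "mate2 1 \<longleftrightarrow> u 0 1 1 2 \<or> u 0 2 1 2" "mate2 2 \<longleftrightarrow> u 0 1 2 1 \<or> u 0 2 2 1"
  by (simp_all add: mate2_def minus_3)

lemma ex_mate: "\<exists>t. mate1 t \<or> mate2 t"
  unfolding ex_3 mate1_iff mate2_iff using ground rules by (smt (z3))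

lemma ex_mate2:
  assumes "mate1 r" "mate1 s" "r \<noteq> s"
  shows "\<exists>t. mate2 t"
proof -
  have "\<exists>t. mate2 t" if "mate1 0" "mate1 1"
    using that unfolding ex_3 mate1_iff mate2_iff using ground rules by (smt (z3))
  moreover have "\<exists>t. mate2 t" if "mate1 0" "mate1 2"
    using that unfolding ex_3 mate1_iff mate2_iff using ground rules by (smt (z3))
  moreover have "\<exists>t. mate2 t" if "mate1 1" "mate1 2"
    using that unfolding ex_3 mate1_iff mate2_iff using ground rules by (smt (z3))
  ultimately show ?thesis
    using assms cases_3[of r] cases_3[of s] by metis
qed

text \<open>Mates at two different positions force every neighbouring line with a coordinate 2 to
  contain a line of slope 1. These known points are the input for the analysis of three
  directions.\<close>

lemma corner01:
  assumes "\<forall>t. mate1 t \<longleftrightarrow> t = 0" "\<forall>t. mate2 t \<longleftrightarrow> t = 1"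
  shows "\<forall>t. u 2 0 t t \<and> u 0 2 t (t + 1) \<and> u 2 2 t (t + 2) \<and> u 2 1 t (t + 1) \<and> u 1 2 t t"
proof -
  have "u 2 0 0 0 \<and> u 2 0 1 1 \<and> u 2 0 2 2 \<and> u 0 2 0 1 \<and> u 0 2 1 2 \<and> u 0 2 2 0 \<and>
    u 2 2 0 2 \<and> u 2 2 1 0 \<and> u 2 2 2 1 \<and> u 2 1 0 1 \<and> u 2 1 1 2 \<and> u 2 1 2 0 \<and> u 1 2 0 0 \<and> u 1 2 1 1 \<and> u 1 2 2 2"
    using assms[unfolded all_3 mate1_iff mate2_iff, simplified] ground rules by (smt (z3))
  then show ?thesis
    by (simp add: all_3 add_3)
qed

end

text \<open>Position and colour are scaled by the same \<open>k\<close>, so reversed lines stay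
  reversed. Any two distinct positions on a line can thereby be moved to 0 and 1.\<close>

lemma (in grid4) affine:
  assumes k: "k \<noteq> 0"
  shows "grid4 (\<lambda>a b t e. u a b (r + k * t) (q + k * e))"
proof
  fix a b t
  have "\<exists>e. u a b (r + k * t) (q + k * e)"
    using total affine_surj_3[OF k] by metis
  then show "u a b (r + k * t) (q + k * 0) \<or> u a b (r + k * t) (q + k * 1) \<or> u a b (r + k * t) (q + k * 2)"
    unfolding ex_3 .
qed (use lines cross affine_3[OF k] in metis)+

lemma (in grid5) affine:
  assumes k: "k \<noteq> 0"
  shows "grid5 (\<lambda>a b c t e. u a b c (r + k * t) (q + k * e))"
proof
  fix a b c t
  have "\<exists>e. u a b c (r + k * t) (q + k * e)"
    using total affine_surj_3[OF k] by metis
  then show "u a b c (r + k * t) (q + k * 0) \<or> u a b c (r + k * t) (q + k * 1) \<or> u a b c (r + k * t) (q + k * 2)"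
    unfolding ex_3 .
qed (use lines cross affine_3[OF k] in metis)+

lemma reversed_affine:
  "k \<noteq> 0 \<Longrightarrow> reversed (\<lambda>t e. f (r + k * t) (q + k * e)) \<Longrightarrow> reversed f"
proof -
  assume k: "k \<noteq> 0" and "reversed (\<lambda>t e. f (r + k * t) (q + k * e))"
  then obtain m where m: "f (r + k * t) (q + k * (m - t))" for t
    unfolding reversed_def by blast
  have "f t (q + k * m + r - t)" for t
  proof -
    have kk: "k * (k * (t - r)) = t - r"
      using square_3[OF k] by (simp add: mult.assoc[symmetric])
    have "k * (m - k * (t - r)) = k * m - (t - r)"
      by (subst right_diff_distrib) (simp only: kk)
    then show ?thesis
      using m[of "k * (t - r)"] kk by (simp only: kk add_diff_eq diff_diff_eq2 add_diff_cancel_left' add.assoc)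
  qed
  then show ?thesis
    unfolding reversed_def by blast
qed

context reversed_plane
begin

lemma swap: "reversed_plane (\<lambda>a b. u b a)"
  by unfold_locales (use total lines cross origin not_reversed in \<open>metis\<close>)+

lemma ex_mate1:
  assumes "mate2 r" "mate2 s" "r \<noteq> s"
  shows "\<exists>t. mate1 t"
  using reversed_plane.ex_mate2[OF swap] assms
  unfolding reversed_plane.mate1_def[OF swap] reversed_plane.mate2_def[OF swap] mate1_def mate2_def by blast

lemma corner:
  assumes "\<forall>t. mate1 t \<longleftrightarrow> t = r" "\<forall>t. mate2 t \<longleftrightarrow> t = s" "r \<noteq> s"
  shows "u 2 0 t (t + r) \<and> u 0 2 t (t + s) \<and> u 2 2 t (t - r - s) \<and> u 2 1 t (t + s) \<and> u 1 2 t (t + r)"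
proof -
  \<comment> \<open>The substitution \<open>r + k * t\<close> sends 0 to \<open>r\<close> and 1 to
    \<open>s\<close>; the colour shift \<open>- r\<close> keeps the central line in the form
    \<open>e = - t\<close>.\<close>
  define k where "k = s - r"
  have k: "k \<noteq> 0"
    using assms(3) by (simp add: k_def)
  define v where "v = (\<lambda>a b t e. u a b (r + k * t) (- r + k * e))"
  have v: "reversed_plane v"
    unfolding v_def reversed_plane_def reversed_plane_axioms_def
  proof (intro conjI affine[OF k] allI impI notI)
    show "u 0 0 (r + k * t) (- r + k * e) \<longleftrightarrow> e = - t" for t e
      using affine_3[OF k, of "- r" e "- t"] origin by simp
  next
    fix a b :: 3
    assume "a = 2 \<or> b = 2" "reversed (\<lambda>t e. u a b (r + k * t) (- r + k * e))"
    then show False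
      using reversed_affine[OF k] not_reversed by blast
  qed
  have "reversed_plane.mate1 v t \<longleftrightarrow> mate1 (r + k * t)" "reversed_plane.mate2 v t \<longleftrightarrow> mate2 (r + k * t)" for t
    unfolding reversed_plane.mate1_def[OF v] reversed_plane.mate2_def[OF v] mate1_def mate2_def
    by (simp_all add: v_def minus_diff_commute)
  then have "reversed_plane.mate1 v t \<longleftrightarrow> t = 0" "reversed_plane.mate2 v t \<longleftrightarrow> t = 1" for t
    using assms(1,2) affine_3[OF k, of r t 0] affine_3[OF k, of r t 1] by (simp_all add: k_def)
  then   have c: "v 2 0 t t \<and> v 0 2 t (t + 1) \<and> v 2 2 t (t + 2) \<and> v 2 1 t (t + 1) \<and> v 1 2 t t" for t
    using reversed_plane.corner01[OF v] by blast
  have "k * (k * (t - r)) = t - r"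
    using square_3[OF k] by (simp add: mult.assoc[symmetric])
  moreover have "- r + (t - r + k * 1) = t + s" "- r + (t - r + k * 2) = t - r - s" "- r + (t - r) = t + r"
    using cases_3[of r] cases_3[of s] cases_3[of t] by (auto simp: k_def minus_3)
  moreover have "r + (t - r) = t"
    by simp
  ultimately show ?thesis
    using c[of "k * (t - r)"] unfolding v_def distrib_left[of k] by (simp only:)
qed

end

locale reversed_box = grid5 +
  assumes origin: "\<forall>t e. u 0 0 0 t e \<longleftrightarrow> e = - t"
    and not_reversed: "\<forall>a b c. a = 2 \<or> b = 2 \<or> c = 2 \<longrightarrow> \<not> reversed (u a b c)"
begin

definition mate1 :: "3 \<Rightarrow> bool" where
  "mate1 t \<longleftrightarrow> u 1 0 0 t (- t) \<or> u 2 0 0 t (- t)"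

definition mate2 :: "3 \<Rightarrow> bool" where
  "mate2 t \<longleftrightarrow> u 0 1 0 t (- t) \<or> u 0 2 0 t (- t)"

definition mate3 :: "3 \<Rightarrow> bool" where
  "mate3 t \<longleftrightarrow> u 0 0 1 t (- t) \<or> u 0 0 2 t (- t)"

sublocale plane12: reversed_plane "\<lambda>a b. u a b 0"
  rewrites "plane12.mate1 = mate1" and "plane12.mate2 = mate2"
proof -
  show *: "reversed_plane (\<lambda>a b. u a b 0)"
    by unfold_locales (use total lines cross origin not_reversed in \<open>metis\<close>)+
  show "reversed_plane.mate1 (\<lambda>a b. u a b 0) = mate1" "reversed_plane.mate2 (\<lambda>a b. u a b 0) = mate2"
    by (simp_all add: fun_eq_iff reversed_plane.mate1_def[OF *] reversed_plane.mate2_def[OF *]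
        mate1_def mate2_def mate3_def)
qed

sublocale plane13: reversed_plane "\<lambda>a c. u a 0 c"
  rewrites "plane13.mate1 = mate1" and "plane13.mate2 = mate3"
proof -
  show *: "reversed_plane (\<lambda>a c. u a 0 c)"
    by unfold_locales (use total lines cross origin not_reversed in \<open>metis\<close>)+
  show "reversed_plane.mate1 (\<lambda>a c. u a 0 c) = mate1" "reversed_plane.mate2 (\<lambda>a c. u a 0 c) = mate3"
    by (simp_all add: fun_eq_iff reversed_plane.mate1_def[OF *] reversed_plane.mate2_def[OF *]
        mate1_def mate2_def mate3_def)
qed

sublocale plane23: reversed_plane "\<lambda>b c. u 0 b c"
  rewrites "plane23.mate1 = mate2" and "plane23.mate2 = mate3"
proof -
  show *: "reversed_plane (\<lambda>b c. u 0 b c)"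
    by unfold_locales (use total lines cross origin not_reversed in \<open>metis\<close>)+
  show "reversed_plane.mate1 (\<lambda>b c. u 0 b c) = mate2" "reversed_plane.mate2 (\<lambda>b c. u 0 b c) = mate3"
    by (simp_all add: fun_eq_iff reversed_plane.mate1_def[OF *] reversed_plane.mate2_def[OF *]
        mate1_def mate2_def mate3_def)
qed

lemma mates_unique:
  "\<not> (mate1 t \<and> mate2 t)" "\<not> (mate1 t \<and> mate3 t)" "\<not> (mate2 t \<and> mate3 t)"
  using cross[of 0 0 0 t "- t"] origin distinct_3 unfolding mate1_def mate2_def mate3_def by metis+

text \<open>All three coordinate planes have mates at two distinct positions, so
  \<open>corner\<close> applies to each of them; the remaining check is finite.\<close>

lemma no_mates_012:
  assumes "\<forall>t. mate1 t \<longleftrightarrow> t = 0" "\<forall>t. mate2 t \<longleftrightarrow> t = 1" "\<forall>t. mate3 t \<longleftrightarrow> t = 2"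
  shows False
proof -
  note ground = origin[unfolded all_3 minus_3 minus_zero, simplified]
    not_reversed[unfolded all_3 reversed_iff, simplified]
  note corners = plane12.corner[OF assms(1,2) distinct_3(1)] plane13.corner[OF assms(1,3) distinct_3(2)]
    plane23.corner[OF assms(2,3) distinct_3(3)]
  have "\<forall>t. u 2 0 0 t t \<and> u 0 2 0 t (t + 1) \<and> u 0 0 2 t (t + 2) \<and>
    u 2 2 0 t (t + 2) \<and> u 2 1 0 t (t + 1) \<and> u 1 2 0 t t \<and>
    u 2 0 2 t (t + 1) \<and> u 2 0 1 t (t + 2) \<and> u 1 0 2 t t \<and>
    u 0 2 2 t t \<and> u 0 2 1 t (t + 2) \<and> u 0 1 2 t (t + 1)"
    using corners[of 0] corners[of 1] corners[of 2] by (simp add: all_3 minus_3 add_3)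
  note c = this[unfolded all_3, simplified, simplified add_3]
  show False
    using ground c rules by (smt (z3))
qed

lemma no_mates_01:
  assumes "\<forall>t. mate1 t \<longleftrightarrow> t = 0" "\<forall>t. mate2 t \<longleftrightarrow> t = 1" "\<forall>t. \<not> mate3 t"
  shows False
proof -
  note ground = origin[unfolded all_3 minus_3 minus_zero, simplified]
  note not_rev =
    not_reversed[rule_format, of 0 0 2] not_reversed[rule_format, of 0 2 1] not_reversed[rule_format, of 0 2 2]
    not_reversed[rule_format, of 1 0 2] not_reversed[rule_format, of 1 2 1] not_reversed[rule_format, of 2 0 1]
    not_reversed[rule_format, of 2 0 2] not_reversed[rule_format, of 2 2 0] not_reversed[rule_format, of 2 2 1]
    not_reversed[rule_format, of 2 2 2]
  note corner = plane12.corner[OF assms(1,2) distinct_3(1)]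
  have "\<forall>t. u 2 0 0 t t \<and> u 0 2 0 t (t + 1) \<and> u 2 2 0 t (t + 2) \<and> u 2 1 0 t (t + 1) \<and> u 1 2 0 t t"
    using corner[of 0] corner[of 1] corner[of 2] by (simp add: all_3 minus_3 add_3)
  note c = this[unfolded all_3, simplified, simplified add_3]
  note m = assms(3)[unfolded mate3_def all_3 minus_3 minus_zero, simplified]
  show False
    using ground not_rev[unfolded reversed_iff, simplified] c m lines cross distinct_3
      total[of 0 0 1] total[of 0 0 2] total[of 0 2 1] total[of 0 2 2] total[of 1 0 2] total[of 1 2 1]
      total[of 2 0 1] total[of 2 0 2] total[of 2 2 0] total[of 2 2 1] total[of 2 2 2]
      \<comment> \<open>the contradiction already arises at these eleven points\<close>
    by (smt (z3))
qed

end

lemma (in reversed_box) no_mates: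
  assumes 1: "\<forall>t. mate1 t \<longleftrightarrow> t = r" and 2: "\<forall>t. mate2 t \<longleftrightarrow> t = s" and "r \<noteq> s"
  shows False
proof -
  define k where "k = s - r"
  have k: "k \<noteq> 0"
    using assms(3) by (simp add: k_def)
  define v where "v = (\<lambda>a b c t e. u a b c (r + k * t) (- r + k * e))"
  have v: "reversed_box v"
    unfolding v_def reversed_box_def reversed_box_axioms_def
  proof (intro conjI affine[OF k] allI impI notI)
    show "u 0 0 0 (r + k * t) (- r + k * e) \<longleftrightarrow> e = - t" for t e
      using affine_3[OF k, of "- r" e "- t"] origin by simp
  next
    fix a b c :: 3
    assume "a = 2 \<or> b = 2 \<or> c = 2" "reversed (\<lambda>t e. u a b c (r + k * t) (- r + k * e))"
    then show False
      using reversed_affine[OF k] not_reversed by blast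
  qed
  have m: "reversed_box.mate1 v t \<longleftrightarrow> mate1 (r + k * t)" "reversed_box.mate2 v t \<longleftrightarrow> mate2 (r + k * t)"
    "reversed_box.mate3 v t \<longleftrightarrow> mate3 (r + k * t)" for t
    unfolding reversed_box.mate1_def[OF v] reversed_box.mate2_def[OF v] reversed_box.mate3_def[OF v]
      mate1_def mate2_def mate3_def
    by (simp_all add: v_def minus_diff_commute)
  then have v1: "\<forall>t. reversed_box.mate1 v t \<longleftrightarrow> t = 0" and v2: "\<forall>t. reversed_box.mate2 v t \<longleftrightarrow> t = 1"
    using 1 2 affine_3[OF k, of r _ 0] affine_3[OF k, of r _ 1] by (simp_all add: k_def)
  \<comment> \<open>A point has only one mate and positions 0 and 1 are used up, so the third
    direction has its mate at position 2 or nowhere.\<close>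
  then have "\<not> reversed_box.mate3 v t" if "t \<noteq> 2" for t
    using reversed_box.mates_unique[OF v, of t] that cases_3[of t] by blast
  then have "(\<forall>t. reversed_box.mate3 v t \<longleftrightarrow> t = 2) \<or> (\<forall>t. \<not> reversed_box.mate3 v t)"
    by metis
  then show False
    using reversed_box.no_mates_012[OF v v1 v2] reversed_box.no_mates_01[OF v v1 v2] by blast
qed

context reversed_box
begin

lemma swap23: "reversed_box (\<lambda>a b c. u a c b)"
  by unfold_locales (use total lines cross origin not_reversed in \<open>metis\<close>)+

lemma rotate: "reversed_box (\<lambda>a b c. u c a b)"
  by unfold_locales (use total lines cross origin not_reversed in \<open>metis\<close>)+

text \<open>Two positions mated in one direction require, by the two planes containing it, a mate in
  each of the other directions. Only the third position is free for both, and it has just one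
  mate.\<close>

lemma mate_unique:
  "mate1 r \<Longrightarrow> mate1 s \<Longrightarrow> r = s" "mate2 r \<Longrightarrow> mate2 s \<Longrightarrow> r = s" "mate3 r \<Longrightarrow> mate3 s \<Longrightarrow> r = s"
proof -
  have third: "t = t'" if "r \<noteq> s" "t \<noteq> r" "t \<noteq> s" "t' \<noteq> r" "t' \<noteq> s" for t t' :: 3
    using that cases_3[of r] cases_3[of s] cases_3[of t] cases_3[of t'] by metis
  show "mate1 r \<Longrightarrow> mate1 s \<Longrightarrow> r = s"
    using plane12.ex_mate2[of r s] plane13.ex_mate2[of r s] mates_unique third by metis
  show "mate2 r \<Longrightarrow> mate2 s \<Longrightarrow> r = s"
    using plane12.ex_mate1[of r s] plane23.ex_mate2[of r s] mates_unique third by metis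
  show "mate3 r \<Longrightarrow> mate3 s \<Longrightarrow> r = s"
    using plane13.ex_mate1[of r s] plane23.ex_mate1[of r s] mates_unique third by metis
qed

text \<open>No two directions can both have mates on the line, by \<open>mate_unique\<close> and
  \<open>no_mates\<close>. Hence two directions have none, and the plane they span contradicts
  \<open>ex_mate\<close>.\<close>

theorem contradiction: False
proof -
  have swap23_mates: "reversed_box.mate1 (\<lambda>a b c. u a c b) = mate1" "reversed_box.mate2 (\<lambda>a b c. u a c b) = mate3"
    unfolding reversed_box.mate1_def[OF swap23] reversed_box.mate2_def[OF swap23] fun_eq_iff mate1_def mate3_def
    by simp_all
  have rotate_mates: "reversed_box.mate1 (\<lambda>a b c. u c a b) = mate2" "reversed_box.mate2 (\<lambda>a b c. u c a b) = mate3"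
    unfolding reversed_box.mate1_def[OF rotate] reversed_box.mate2_def[OF rotate] fun_eq_iff mate2_def mate3_def
    by simp_all
  have single: "\<forall>t. mate1 t \<longleftrightarrow> t = r" if "mate1 r" for r
    using that mate_unique by blast
  have single2: "\<forall>t. mate2 t \<longleftrightarrow> t = r" if "mate2 r" for r
    using that mate_unique by blast
  have single3: "\<forall>t. mate3 t \<longleftrightarrow> t = r" if "mate3 r" for r
    using that mate_unique by blast
  have "\<not> (mate1 r \<and> mate2 s)" for r s
    using no_mates[OF single single2] mates_unique by blast
  moreover have "\<not> (mate1 r \<and> mate3 s)" for r s
    using reversed_box.no_mates[OF swap23, unfolded swap23_mates, OF single single3] mates_unique by blast
  moreover have "\<not> (mate2 r \<and> mate3 s)" for r s
    using reversed_box.no_mates[OF rotate, unfolded rotate_mates, OF single2 single3] mates_unique by blast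
  ultimately show False
    using plane12.ex_mate plane13.ex_mate plane23.ex_mate by metis
qed

end

section \<open>Saturated sets of maximum degree 1\<close>

lemma axis_zero [simp]: "axis j (0 :: 3) = 0"
  by (simp add: vec_eq_iff axis_def)

lemma axis_add: "axis j (a + b :: 3) = axis j a + axis j b"
  by (simp add: vec_eq_iff axis_def)

lemma axis_diff: "axis j (a - b :: 3) = axis j a - axis j b"
  by (simp add: vec_eq_iff axis_def)

lemma axis_minus: "axis j (- a :: 3) = - axis j a"
  by (simp add: vec_eq_iff axis_def)

text \<open>The set on the right is empty if \<open>A\<close> has one element and consists of the
  missing point if \<open>A\<close> has two.\<close>

lemma card_fibre:
  fixes A :: "3 set"
  assumes "A \<noteq> {}" "A \<noteq> UNIV"
  shows "card A = 1 + card {e. e \<notin> A \<and> e + 1 \<in> A \<and> e + 2 \<in> A}"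
proof -
  define B where "B = {e. e \<notin> A \<and> e + 1 \<in> A \<and> e + 2 \<in> A}"
  have split: "C = (if 0 \<in> C then {0} else {}) \<union> (if 1 \<in> C then {1} else {}) \<union> (if 2 \<in> C then {2} else {})" for C :: "3 set"
    unfolding set_eq_iff all_3 by auto
  have B: "0 \<in> B \<longleftrightarrow> 0 \<notin> A \<and> 1 \<in> A \<and> 2 \<in> A" "1 \<in> B \<longleftrightarrow> 1 \<notin> A \<and> 2 \<in> A \<and> 0 \<in> A"
    "2 \<in> B \<longleftrightarrow> 2 \<notin> A \<and> 0 \<in> A \<and> 1 \<in> A"
    by (simp_all add: B_def add_3)
  have "0 \<in> A \<or> 1 \<in> A \<or> 2 \<in> A" "\<not> (0 \<in> A \<and> 1 \<in> A \<and> 2 \<in> A)"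
    using assms split[of A] UNIV_3 by auto
  then have "card A = 1 + card B"
    by (subst split[of A], subst split[of B]) (auto simp: B)
  then show ?thesis
    by (simp add: B_def)
qed

lemma card_fibres:
  fixes A :: "(3 ^ 'n::finite) set"
  shows "card A = (\<Sum>y | y $ i = 0. card {e. y + axis i e \<in> A})"
proof -
  define S where "S = (SIGMA y:{y. y $ i = 0}. {e. y + axis i e \<in> A})"
  have "A = (\<lambda>(y, e). y + axis i e) ` S"
  proof (intro equalityI subsetI)
    fix x
    assume "x \<in> A"
    moreover have "x = (x - axis i (x $ i)) + axis i (x $ i)" "(x - axis i (x $ i)) $ i = 0"
      by (simp_all add: axis_def)
    ultimately show "x \<in> (\<lambda>(y, e). y + axis i e) ` S"
      by (intro image_eqI[of _ _ "(x - axis i (x $ i), x $ i)"]) (auto simp: S_def)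
  qed (auto simp: S_def)
  moreover have "inj_on (\<lambda>(y, e). y + axis i e) S"
  unfolding S_def
  proof (rule inj_onI, clarsimp)
    fix y z :: "3 ^ 'n" and e f
    assume yz: "y $ i = 0" "z $ i = 0" and eq: "y + axis i e = z + axis i f"
    have "(y + axis i e) $ i = (z + axis i f) $ i"
      unfolding eq ..
    then have "e = f"
      using yz by (simp add: axis_def)
    with eq show "y = z \<and> e = f"
      by simp
  qed
  ultimately have "card A = card S"
    by (metis card_image)
  then show ?thesis
    by (simp add: S_def)
qed

lemma card_hyperplane: "card {y :: 3 ^ 'n::finite. y $ i = 0} = 3 ^ (CARD('n) - 1)"
proof -
  have "3 ^ CARD('n) = card (UNIV :: (3 ^ 'n) set)"
    by simp
  also have "\<dots> = card {y :: 3 ^ 'n. y $ i = 0} * 3"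
    by (subst card_fibres[of _ i]) simp
  finally have "card {y :: 3 ^ 'n. y $ i = 0} * 3 = 3 ^ CARD('n)" ..
  also have "\<dots> = 3 ^ (CARD('n) - 1) * 3"
    by (metis One_nat_def Suc_diff_1 zero_less_card_finite power_Suc2)
  finally show ?thesis
    by simp
qed

lemma obtain_three:
  assumes "3 \<le> card A"
  obtains a b c where "{a, b, c} \<subseteq> A" "a \<noteq> b" "a \<noteq> c" "b \<noteq> c"
proof -
  obtain T where "T \<subseteq> A" "card T = 3"
    using obtain_subset_with_card_n[OF assms] by blast
  then show thesis
    using that by (auto simp: card_3_iff)
qed

text \<open>This is the bound \<open>R(3,3) \<le> 6\<close>, with \<open>P\<close> and its negation
  as the two colours: a fixed vertex has three neighbours of one colour.\<close>

lemma monochromatic_triangle: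
  assumes "6 \<le> card M" and sym: "\<And>k l. P k l \<longleftrightarrow> P l k"
  obtains k l m where "{k, l, m} \<subseteq> M" "k \<noteq> l" "k \<noteq> m" "l \<noteq> m" "P k l = P k m" "P k l = P l m"
proof -
  have "finite M" "M \<noteq> {}"
    using assms by (auto intro: card_ge_0_finite)
  then obtain w where w: "w \<in> M"
    by blast
  have "M - {w} = {k \<in> M - {w}. P w k} \<union> {k \<in> M - {w}. \<not> P w k}"
    by blast
  then have "card (M - {w}) \<le> card {k \<in> M - {w}. P w k} + card {k \<in> M - {w}. \<not> P w k}"
    by (metis card_Un_le)
  moreover have "5 \<le> card (M - {w})"
    using assms(1) w by simp
  \<comment> \<open>Both halves are written as \<open>P w k = Q\<close>, so that one argument serves
    for either colour.\<close>
  ultimately have "3 \<le> card {k \<in> M - {w}. P w k = True} \<or> 3 \<le> card {k \<in> M - {w}. P w k = False}"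
    by simp linarith
  then obtain Q where "3 \<le> card {k \<in> M - {w}. P w k = Q}"
    by blast
  then obtain a b c where abc: "{a, b, c} \<subseteq> {k \<in> M - {w}. P w k = Q}" "a \<noteq> b" "a \<noteq> c" "b \<noteq> c"
    by (rule obtain_three)
  show thesis
  proof (cases "P a b = Q \<or> P a c = Q \<or> P b c = Q")
    case True
    then show thesis
      using that[of w a b] that[of w a c] that[of w b c] abc w by auto
  next
    case False
    then show thesis
      using that[of a b c] abc by auto
  qed
qed

text \<open>The degree bound takes the form that a point of \<open>U\<close> has at most one mate.
  The directions \<open>j\<close> and \<open>k\<close> may be \<open>i\<close>, so two colours of
  one point also count as mates.\<close>

locale configuration =
  fixes U :: "(3 ^ 'n::finite) set" and i :: 'n
  assumes fibre: "\<exists>e. x + axis i e \<in> U"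
    and mates: "x \<in> U \<Longrightarrow> x + axis j a \<in> U \<Longrightarrow> x + axis k b \<in> U \<Longrightarrow> a \<noteq> 0 \<Longrightarrow> b \<noteq> 0 \<Longrightarrow> j = k \<and> a = b"
begin

section \<open>Restrictions of \<open>U\<close> to affine subspaces\<close>

lemma lineI:
  assumes "p \<in> U" "q \<in> U" "r \<in> U" "q - p = axis j (f * (a' - a))" "r - p = axis j (f * (a'' - a))" "f \<noteq> 0"
  shows "a = a' \<or> a = a'' \<or> a' = a''"
proof -
  have "q = p + axis j (f * (a' - a))" "r = p + axis j (f * (a'' - a))"
    using assms(4,5) by (metis add_diff_cancel_left' add.commute diff_add_cancel)+
  then have "f * (a' - a) = 0 \<or> f * (a'' - a) = 0 \<or> f * (a' - a) = f * (a'' - a)"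
    using mates assms(1-3) by blast
  then show ?thesis
    using \<open>f \<noteq> 0\<close> by (auto simp: scale_eq_3)
qed

lemma crossI:
  assumes "p \<in> U" "q \<in> U" "r \<in> U" "q - p = axis j (f * (a' - a))" "r - p = axis k (g * (b' - b))"
    "j \<noteq> k" "f \<noteq> 0" "g \<noteq> 0"
  shows "a = a' \<or> b = b'"
proof -
  have "q = p + axis j (f * (a' - a))" "r = p + axis k (g * (b' - b))"
    using assms(4,5) by (metis add_diff_cancel_left' add.commute diff_add_cancel)+
  then have "f * (a' - a) = 0 \<or> g * (b' - b) = 0"
    using mates assms(1-3,6) by blast
  then show ?thesis
    using assms(7,8) by auto
qed

lemma fibre_scaled:
  assumes "g \<noteq> 0"
  shows "x + axis i (g * 0) \<in> U \<or> x + axis i (g * 1) \<in> U \<or> x + axis i (g * 2) \<in> U"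
proof -
  have "\<exists>e. x + axis i (g * e) \<in> U"
    using fibre[of x] scale_scale_3[OF assms] by metis
  then show ?thesis
    unfolding ex_3 .
qed

text \<open>The factors allow any coordinate, and the colour, to be negated independently.\<close>

lemma grid3_at:
  assumes "j \<noteq> k" "j \<noteq> i" "k \<noteq> i" "f \<noteq> 0" "g \<noteq> 0" "w \<noteq> 0"
  shows "grid3 (\<lambda>a b e. x + axis j (f * a) + axis k (g * b) + axis i (w * e) \<in> U)"
proof (unfold_locales, goal_cases)
  case 1
  then show ?case
    using assms by (intro fibre_scaled)
next
  case 2
  then show ?case
    by (rule lineI[where j = j and f = f]) (simp_all add: assms axis_diff right_diff_distrib)
next
  case 3
  then show ?case
    by (rule lineI[where j = k and f = g]) (simp_all add: assms axis_diff right_diff_distrib)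
next
  case 4
  then show ?case
    by (rule lineI[where j = i and f = w]) (simp_all add: assms axis_diff right_diff_distrib)
next
  case 5
  then show ?case
    by (rule crossI[where j = j and f = f and k = k and g = g]) (simp_all add: assms axis_diff right_diff_distrib)
next
  case 6
  then show ?case
    by (rule crossI[where j = j and f = f and k = i and g = w]) (simp_all add: assms axis_diff right_diff_distrib)
next
  case 7
  then show ?case
    by (rule crossI[where j = k and f = g and k = i and g = w]) (simp_all add: assms axis_diff right_diff_distrib)
qed

lemma grid4_at:
  assumes "j \<noteq> k" "j \<noteq> l" "j \<noteq> i" "k \<noteq> l" "k \<noteq> i" "l \<noteq> i"
    "f \<noteq> 0" "g \<noteq> 0" "h \<noteq> 0" "w \<noteq> 0"
  shows "grid4 (\<lambda>a b c e. x + axis j (f * a) + axis k (g * b) + axis l (h * c) + axis i (w * e) \<in> U)"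
proof (unfold_locales, goal_cases)
  case 1
  then show ?case
    using assms by (intro fibre_scaled)
next
  case 2
  then show ?case
    by (rule lineI[where j = j and f = f]) (simp_all add: assms axis_diff right_diff_distrib)
next
  case 3
  then show ?case
    by (rule lineI[where j = k and f = g]) (simp_all add: assms axis_diff right_diff_distrib)
next
  case 4
  then show ?case
    by (rule lineI[where j = l and f = h]) (simp_all add: assms axis_diff right_diff_distrib)
next
  case 5
  then show ?case
    by (rule lineI[where j = i and f = w]) (simp_all add: assms axis_diff right_diff_distrib)
next
  case 6
  then show ?case
    by (rule crossI[where j = j and f = f and k = k and g = g]) (simp_all add: assms axis_diff right_diff_distrib)
next
  case 7
  then show ?case
    by (rule crossI[where j = j and f = f and k = l and g = h]) (simp_all add: assms axis_diff right_diff_distrib)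
next
  case 8
  then show ?case
    by (rule crossI[where j = j and f = f and k = i and g = w]) (simp_all add: assms axis_diff right_diff_distrib)
next
  case 9
  then show ?case
    by (rule crossI[where j = k and f = g and k = l and g = h]) (simp_all add: assms axis_diff right_diff_distrib)
next
  case 10
  then show ?case
    by (rule crossI[where j = k and f = g and k = i and g = w]) (simp_all add: assms axis_diff right_diff_distrib)
next
  case 11
  then show ?case
    by (rule crossI[where j = l and f = h and k = i and g = w]) (simp_all add: assms axis_diff right_diff_distrib)
qed

lemma grid5_at:
  assumes "j \<noteq> k" "j \<noteq> l" "j \<noteq> m" "j \<noteq> i" "k \<noteq> l" "k \<noteq> m" "k \<noteq> i" "l \<noteq> m" "l \<noteq> i" "m \<noteq> i"
    "f \<noteq> 0" "g \<noteq> 0" "h \<noteq> 0" "q \<noteq> 0" "w \<noteq> 0"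
  shows "grid5 (\<lambda>a b c d e. x + axis j (f * a) + axis k (g * b) + axis l (h * c) + axis m (q * d) + axis i (w * e) \<in> U)"
proof (unfold_locales, goal_cases)
  case 1
  then show ?case
    using assms by (intro fibre_scaled)
next
  case 2
  then show ?case
    by (rule lineI[where j = j and f = f]) (simp_all add: assms axis_diff right_diff_distrib)
next
  case 3
  then show ?case
    by (rule lineI[where j = k and f = g]) (simp_all add: assms axis_diff right_diff_distrib)
next
  case 4
  then show ?case
    by (rule lineI[where j = l and f = h]) (simp_all add: assms axis_diff right_diff_distrib)
next
  case 5
  then show ?case
    by (rule lineI[where j = m and f = q]) (simp_all add: assms axis_diff right_diff_distrib)
next
  case 6
  then show ?case
    by (rule lineI[where j = i and f = w]) (simp_all add: assms axis_diff right_diff_distrib)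
next
  case 7
  then show ?case
    by (rule crossI[where j = j and f = f and k = k and g = g]) (simp_all add: assms axis_diff right_diff_distrib)
next
  case 8
  then show ?case
    by (rule crossI[where j = j and f = f and k = l and g = h]) (simp_all add: assms axis_diff right_diff_distrib)
next
  case 9
  then show ?case
    by (rule crossI[where j = j and f = f and k = m and g = q]) (simp_all add: assms axis_diff right_diff_distrib)
next
  case 10
  then show ?case
    by (rule crossI[where j = j and f = f and k = i and g = w]) (simp_all add: assms axis_diff right_diff_distrib)
next
  case 11
  then show ?case
    by (rule crossI[where j = k and f = g and k = l and g = h]) (simp_all add: assms axis_diff right_diff_distrib)
next
  case 12
  then show ?case
    by (rule crossI[where j = k and f = g and k = m and g = q]) (simp_all add: assms axis_diff right_diff_distrib)
next
  case 13
  then show ?case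
    by (rule crossI[where j = k and f = g and k = i and g = w]) (simp_all add: assms axis_diff right_diff_distrib)
next
  case 14
  then show ?case
    by (rule crossI[where j = l and f = h and k = m and g = q]) (simp_all add: assms axis_diff right_diff_distrib)
next
  case 15
  then show ?case
    by (rule crossI[where j = l and f = h and k = i and g = w]) (simp_all add: assms axis_diff right_diff_distrib)
next
  case 16
  then show ?case
    by (rule crossI[where j = m and f = q and k = i and g = w]) (simp_all add: assms axis_diff right_diff_distrib)
qed

text \<open>
  Hubs are more general than points of \<open>D\<close>: translating a hub along a direction that dominates all of \<open>S\<close>
  yields a hub for the other directions. The colour of the neighbours is normalised to 0 by the choice of
  the coordinate of \<open>x\<close> in direction \<open>i\<close>.
\<close>

definition hub :: "3 ^ 'n \<Rightarrow> 'n set \<Rightarrow> bool" where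
  "hub x S \<longleftrightarrow> (\<forall>j\<in>S. \<forall>b e. b \<noteq> 0 \<longrightarrow> (x + axis j b + axis i e \<in> U \<longleftrightarrow> e = 0))"

definition dominates :: "3 \<Rightarrow> 3 ^ 'n \<Rightarrow> 'n \<Rightarrow> 'n \<Rightarrow> bool" where
  "dominates s x j k \<longleftrightarrow> s \<noteq> 0 \<and>
    (\<forall>a b e. a \<noteq> 0 \<longrightarrow> b \<noteq> 0 \<longrightarrow> (x + axis j a + axis k b + axis i e \<in> U \<longleftrightarrow> e = s * a))"

definition par :: "3 \<Rightarrow> 3 ^ 'n \<Rightarrow> 'n \<Rightarrow> 'n \<Rightarrow> bool" where
  "par s x j k \<longleftrightarrow> s \<noteq> 0 \<and>
    (\<forall>a b e. a \<noteq> 0 \<longrightarrow> b \<noteq> 0 \<longrightarrow> (x + axis j a + axis k b + axis i e \<in> U \<longleftrightarrow> e = s * a * b))"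

lemma point_swap: "x + axis k b + axis j a + axis i e = x + axis j a + axis k b + axis i (e :: 3)"
  by (simp add: add.assoc add.left_commute)

lemma hubD: "hub x S \<Longrightarrow> j \<in> S \<Longrightarrow> b \<noteq> 0 \<Longrightarrow> x + axis j b + axis i e \<in> U \<longleftrightarrow> e = 0"
  by (simp add: hub_def)

lemma hubD0: "hub x S \<Longrightarrow> j \<in> S \<Longrightarrow> b \<noteq> 0 \<Longrightarrow> x + axis j b \<in> U"
  using hubD[of x S j b 0] by simp

lemma hub_mono: "hub x S \<Longrightarrow> T \<subseteq> S \<Longrightarrow> hub x T"
  by (auto simp: hub_def)

lemma dominatesD: "dominates s x j k \<Longrightarrow> a \<noteq> 0 \<Longrightarrow> b \<noteq> 0 \<Longrightarrow> x + axis j a + axis k b + axis i e \<in> U \<longleftrightarrow> e = s * a"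
  by (simp add: dominates_def)

lemma dominatesD': "dominates s x j k \<Longrightarrow> a \<noteq> 0 \<Longrightarrow> b \<noteq> 0 \<Longrightarrow> x + axis k b + axis j a + axis i e \<in> U \<longleftrightarrow> e = s * a"
  unfolding point_swap[of x k] by (rule dominatesD)

lemma parD: "par s x j k \<Longrightarrow> a \<noteq> 0 \<Longrightarrow> b \<noteq> 0 \<Longrightarrow> x + axis j a + axis k b + axis i e \<in> U \<longleftrightarrow> e = s * a * b"
  by (simp add: par_def)

lemma dominates_nonzero: "dominates s x j k \<Longrightarrow> s \<noteq> 0"
  by (simp add: dominates_def)

lemma par_nonzero: "par s x j k \<Longrightarrow> s \<noteq> 0"
  by (simp add: par_def)

lemma par_commute: "par s x j k \<longleftrightarrow> par s x k j"
proof -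
  have "par s x k j" if "par s x j k" for j k
    using that unfolding par_def by (simp add: point_swap[of x k _ j] mult.assoc mult.left_commute mult.commute)
  then show ?thesis
    by blast
qed

lemma dominates_par: "dominates s x j k \<Longrightarrow> \<not> par q x j k"
proof
  assume d: "dominates s x j k" and p: "par q x j k"
  have "s = q" "s = q * 2"
    using dominatesD[OF d, of 1 1 s] parD[OF p, of 1 1 s] dominatesD[OF d, of 1 2 s] parD[OF p, of 1 2 s] by simp_all
  then show False
    using cases_3[of q] par_nonzero[OF p] by auto
qed

lemma dominates_par': "dominates s x k j \<Longrightarrow> \<not> par q x j k"
  using dominates_par par_commute by blast

lemma dominates_asym: "dominates s x j k \<Longrightarrow> \<not> dominates r x k j"
proof
  assume d: "dominates s x j k" and p: "dominates r x k j"
  have "s = r" "s = r * 2"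
    using dominatesD[OF d, of 1 1 s] dominatesD'[OF p, of 1 1 s] dominatesD[OF d, of 1 2 s] dominatesD'[OF p, of 2 1 s] by simp_all
  then show False
    using cases_3[of r] dominates_nonzero[OF p] by auto
qed

section \<open>The local analysis for arbitrary signs\<close>

lemma hub_cases:
  assumes "hub x {j, k}" "j \<noteq> k" "j \<noteq> i" "k \<noteq> i"
  obtains s where "dominates s x j k" | s where "dominates s x k j" | s where "par s x j k"
proof -
  interpret grid3 "\<lambda>a b e. x + axis j (1 * a) + axis k (1 * b) + axis i (1 * e) \<in> U"
    using assms by (intro grid3_at) simp_all
  have 1: "\<forall>a e. a \<noteq> 0 \<longrightarrow> (x + axis j (1 * a) + axis k (1 * 0) + axis i (1 * e) \<in> U \<longleftrightarrow> e = 0)"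
    using hubD[OF assms(1), of j] by simp
  have 2: "\<forall>b e. b \<noteq> 0 \<longrightarrow> (x + axis j (1 * 0) + axis k (1 * b) + axis i (1 * e) \<in> U \<longleftrightarrow> e = 0)"
    using hubD[OF assms(1), of k] by simp
  obtain s where "s \<noteq> 0" and s:
    "(\<forall>a b e. a \<noteq> 0 \<longrightarrow> b \<noteq> 0 \<longrightarrow> (x + axis j a + axis k b + axis i e \<in> U \<longleftrightarrow> e = s * a)) \<or>
     (\<forall>a b e. a \<noteq> 0 \<longrightarrow> b \<noteq> 0 \<longrightarrow> (x + axis j a + axis k b + axis i e \<in> U \<longleftrightarrow> e = s * b)) \<or>
     (\<forall>a b e. a \<noteq> 0 \<longrightarrow> b \<noteq> 0 \<longrightarrow> (x + axis j a + axis k b + axis i e \<in> U \<longleftrightarrow> e = s * a * b))"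
    using hub_plane[OF 1 2] unfolding mult_1 by blast
  then have "dominates s x j k \<or> dominates s x k j \<or> par s x j k"
    using \<open>s \<noteq> 0\<close> unfolding dominates_def par_def by (auto simp: point_swap[of x k _ j])
  then show thesis
    using that by blast
qed

text \<open>The factors \<open>f\<close>, \<open>g\<close>, \<open>h\<close> are chosen in each
  application so that as many signs as possible become 1, which reduces it to the normal forms
  above.\<close>

lemma grid4_hub:
  assumes hub: "hub x {j, k, l}" and ne: "j \<noteq> i" "k \<noteq> i" "l \<noteq> i" "j \<noteq> k" "j \<noteq> l" "k \<noteq> l"
    and nz: "f \<noteq> 0" "g \<noteq> 0" "h \<noteq> 0"
  defines "u \<equiv> \<lambda>a b c e. x + axis j (f * a) + axis k (g * b) + axis l (h * c) + axis i (1 * e) \<in> U"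
  shows "grid4 u"
    "\<forall>a e. a \<noteq> 0 \<longrightarrow> (u a 0 0 e \<longleftrightarrow> e = 0)"
    "\<forall>b e. b \<noteq> 0 \<longrightarrow> (u 0 b 0 e \<longleftrightarrow> e = 0)"
    "\<forall>c e. c \<noteq> 0 \<longrightarrow> (u 0 0 c e \<longleftrightarrow> e = 0)"
  unfolding u_def
  by (rule grid4_at) (use hubD[OF hub] ne nz in simp_all)

lemma no_cycle:
  assumes hub: "hub x {j, k, l}" and ne: "j \<noteq> i" "k \<noteq> i" "l \<noteq> i" "j \<noteq> k" "j \<noteq> l" "k \<noteq> l"
    and d: "dominates s x j k" "dominates r x k l" "dominates t x l j"
  shows False
proof -
  note nz = d[THEN dominates_nonzero]
  show False
    by (rule grid4.no_cycle[OF grid4_hub[OF hub ne nz]])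
      (simp_all add: dominatesD[OF d(1)] dominatesD[OF d(2)] dominatesD'[OF d(3)] nz)
qed

lemma no_chain_par:
  assumes hub: "hub x {j, k, l}" and ne: "j \<noteq> i" "k \<noteq> i" "l \<noteq> i" "j \<noteq> k" "j \<noteq> l" "k \<noteq> l"
    and d: "dominates s x j k" "dominates r x k l" "par q x j l"
  shows False
proof -
  note nz = d(1,2)[THEN dominates_nonzero] par_nonzero[OF d(3)]
  \<comment> \<open>With \<open>j\<close> scaled by \<open>s\<close>, the factor
    \<open>s * q\<close> on \<open>l\<close> turns the sign of the parallel pair into 1.\<close>
  have h: "s * q \<noteq> 0"
    using nz by simp
  have "q * (s * a) * (s * q * c) = a * c" for a c
    using square_3[OF nz(1)] square_3[OF nz(3)] by (metis (no_types, lifting) mult.assoc mult.commute mult_1)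
  then show False
    by (intro grid4.no_chain_par[OF grid4_hub[OF hub ne nz(1,2) h]])
      (simp_all add: dominatesD[OF d(1)] dominatesD[OF d(2)] parD[OF d(3)] nz)
qed

lemma no_fork_par:
  assumes hub: "hub x {j, k, l}" and ne: "j \<noteq> i" "k \<noteq> i" "l \<noteq> i" "j \<noteq> k" "j \<noteq> l" "k \<noteq> l"
    and d: "dominates s x j k" "dominates r x l k" "par q x j l"
  shows False
proof -
  note nz = d(1,2)[THEN dominates_nonzero] par_nonzero[OF d(3)]
  have q: "q * s * r \<noteq> 0"
    using nz by simp
  have 1: "q * (s * a) * (r * c) = q * s * r * a * c" for a c
    by (simp add: ac_simps)
  show False
    by (intro grid4.no_fork_par[OF grid4_hub[OF hub ne nz(1) one_neq_zero nz(2)] _ _ _ q])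
      (simp_all add: dominatesD[OF d(1)] dominatesD'[OF d(2)] parD[OF d(3)] nz 1)
qed

lemma dominance_sign:
  assumes hub: "hub x {j, k, l}" and ne: "j \<noteq> i" "k \<noteq> i" "l \<noteq> i" "j \<noteq> k" "j \<noteq> l" "k \<noteq> l"
    and d: "dominates s x j k" "dominates r x j l"
  shows "s = r"
proof (rule ccontr)
  note nz = d[THEN dominates_nonzero]
  assume "s \<noteq> r"
  then have "r * s = 2"
    using cases_3[of s] cases_3[of r] nz by auto
  then have "r * (s * a) = 2 * a" for a
    by (metis mult.assoc)
  then show False
    by (intro grid4.dominance_sign[OF grid4_hub[OF hub ne nz(1) one_neq_zero one_neq_zero]])
      (simp_all add: dominatesD[OF d(1)] dominatesD[OF d(2)] nz)
qed

lemma chain_colour: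
  assumes hub: "hub x {j, k, l}" and ne: "j \<noteq> i" "k \<noteq> i" "l \<noteq> i" "j \<noteq> k" "j \<noteq> l" "k \<noteq> l"
    and d: "dominates s x j k" "dominates t x j l" "dominates r x k l" and abc: "a \<noteq> 0" "b \<noteq> 0" "c \<noteq> 0"
  shows "x + axis j a + axis k b + axis l c + axis i e \<in> U \<longleftrightarrow> e = s * a + r * b"
proof -
  note nz = d(1,3)[THEN dominates_nonzero]
  have "t = s"
    using dominance_sign[OF hub ne d(1,2)] ..
  have "\<forall>a b c e. a \<noteq> 0 \<longrightarrow> b \<noteq> 0 \<longrightarrow> c \<noteq> 0 \<longrightarrow>
    (x + axis j (s * a) + axis k (r * b) + axis l (1 * c) + axis i (1 * e) \<in> U \<longleftrightarrow> e = a + b)"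
    by (rule grid4.chain_colour[OF grid4_hub[OF hub ne nz one_neq_zero]])
      (simp_all add: dominatesD[OF d(1)] dominatesD[OF d(2)] dominatesD[OF d(3)] nz \<open>t = s\<close>)
  from this[rule_format, of "s * a" "r * b" c e] show ?thesis
    using nz abc by simp
qed

lemma dominance_par_mates:
  assumes hub: "hub x {j, k, l}" and ne: "j \<noteq> i" "k \<noteq> i" "l \<noteq> i" "j \<noteq> k" "j \<noteq> l" "k \<noteq> l"
    and d: "dominates s x j k" "par q x j l" "par r x k l" and a: "a \<noteq> 0"
  shows "\<exists>b. b \<noteq> 0 \<and> x + axis j a + axis k b + axis l (2 * s * q) + axis i (2 * s * a) \<in> U"
proof -
  note nz = dominates_nonzero[OF d(1)] d(2,3)[THEN par_nonzero]
  define g where "g = r * s * q"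
  have g: "g \<noteq> 0" and h: "s * q \<noteq> 0"
    using nz by (simp_all add: g_def)
  have 1: "q * (s * a) * (s * q * c) = a * c" for a c
    using square_3[OF nz(1)] square_3[OF nz(2)] by (metis (no_types, lifting) mult.assoc mult.commute mult_1)
  have "g * (r * (s * q)) = 1"
    using square_3[OF g] by (simp add: g_def mult.assoc)
  then have 2: "r * (g * b) * (s * q * c) = b * c" for b c
    by (metis (no_types, lifting) mult.assoc mult.commute mult_1)
  have *: "x + axis j (s * 1) + axis k (g * 2) + axis l (s * q * 2) + axis i (1 * 2) \<in> U"
    "x + axis j (s * 2) + axis k (g * 1) + axis l (s * q * 2) + axis i (1 * 1) \<in> U"
    by (rule grid4.dominance_par_mates[OF grid4_hub[OF hub ne nz(1) g h]];
        use 1 2 in \<open>simp add: dominatesD[OF d(1)] parD[OF d(2)] parD[OF d(3)] nz g\<close>)+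
  have "s * (s * a) = a"
    using nz by simp
  have l: "2 * s * q = s * q * 2"
    by (simp add: ac_simps)
  consider "s * a = 1" | "s * a = 2"
    using cases_3[of "s * a"] nz a by fastforce
  then show ?thesis
  proof cases
    case 1
    then have "a = s * 1" "2 * s * a = 1 * 2"
      using \<open>s * (s * a) = a\<close> by (simp_all add: mult.assoc)
    with *(1) g show ?thesis
      by (intro exI[of _ "g * 2"]) (simp add: l del: mult_1)
  next
    case 2
    then have "a = s * 2" "2 * s * a = 1 * 1"
      using \<open>s * (s * a) = a\<close> by (simp_all add: mult.assoc)
    with *(2) g show ?thesis
      by (intro exI[of _ "g * 1"]) (simp add: l del: mult_1)
  qed
qed

lemma no_dominance_par_square:
  assumes hub: "hub x {j, k, l, m}"
    and ne: "j \<noteq> i" "k \<noteq> i" "l \<noteq> i" "m \<noteq> i" "j \<noteq> k" "j \<noteq> l" "j \<noteq> m" "k \<noteq> l" "k \<noteq> m" "l \<noteq> m"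
    and d: "dominates s x j k" "par q x j l" "par q' x j m" "par r x k l" "par r' x k m" "par p x l m"
  shows "q * r \<noteq> q' * r'"
proof
  assume eq: "q * r = q' * r'"
  note nz = dominates_nonzero[OF d(1)] d(2-6)[THEN par_nonzero]
  note sq = nz[THEN square_3]
  \<comment> \<open>One factor on \<open>k\<close> has to normalise both \<open>r\<close> and
    \<open>r'\<close>; it exists because \<open>q * r = q' * r'\<close>. The sign between
    \<open>l\<close> and \<open>m\<close> is then determined and stays as a parameter.\<close>
  define f where "f = q * r * s"
  have f: "f \<noteq> 0" "s * q \<noteq> 0" "s * q' \<noteq> 0" and z: "p * (s * q) * (s * q') \<noteq> 0"
    using nz by (simp_all add: f_def)
  interpret grid5 "\<lambda>a b c d e. x + axis j (s * a) + axis k (f * b) + axis l (s * q * c) + axis m (s * q' * d) + axis i (1 * e) \<in> U"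
    by (rule grid5_at) (use ne nz f in simp_all)
  have "q * (s * a) * (s * q * c) = a * c" "q' * (s * a) * (s * q' * c) = a * c" for a c
    using sq by (metis (no_types, lifting) mult.assoc mult.commute mult_1)+
  note 1 = this
  have "r * f * (s * q) = (r * r) * (s * s) * (q * q)" "r' * f * (s * q') = (q' * r') * (q * r) * (s * s)"
    by (simp_all add: f_def ac_simps)
  then have "r * f * (s * q) = 1" "r' * f * (s * q') = 1"
    using sq eq square_3[of "q * r"] nz by simp_all
  then have 2: "r * (f * b) * (s * q * c) = b * c" "r' * (f * b) * (s * q' * c) = b * c" for b c
    by (metis (no_types, lifting) mult.assoc mult.commute mult_1)+
  have 3: "p * (s * q * c) * (s * q' * d) = p * (s * q) * (s * q') * c * d" for c d
    by (simp add: ac_simps)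
  show False
    by (intro no_dominance_par_square[OF _ _ _ _ _ _ _ _ _ _ z])
      (simp_all add: hubD[OF hub] dominatesD[OF d(1)] parD[OF d(2)] parD[OF d(3)] parD[OF d(4)] parD[OF d(5)] parD[OF d(6)] nz f 1 2 3)
qed

text \<open>Negating a coordinate changes two signs of a triangle and so keeps their product; only
  negating the colours changes it. Hence the colour axis is scaled by the common product
  \<open>t\<close>, and the other factors normalise the signs at \<open>j\<close>.\<close>

lemma no_coherent_par_square:
  assumes hub: "hub x {j, k, l, m}"
    and ne: "j \<noteq> i" "k \<noteq> i" "l \<noteq> i" "m \<noteq> i" "j \<noteq> k" "j \<noteq> l" "j \<noteq> m" "k \<noteq> l" "k \<noteq> m" "l \<noteq> m"
    and d: "par q x j k" "par q' x j l" "par q'' x j m" "par p x k l" "par p' x k m" "par p'' x l m"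
    and t: "q * q' * p = t" "q * q'' * p' = t" "q' * q'' * p'' = t"
  shows False
proof -
  note nz = d[THEN par_nonzero]
  have t0: "t \<noteq> 0"
    using t(1) nz by auto
  note sq = nz[THEN square_3] square_3[OF t0]
  have f: "t * q \<noteq> 0" "t * q' \<noteq> 0" "t * q'' \<noteq> 0"
    using nz t0 by simp_all
  have *: "t * e = t * (a * b) \<longleftrightarrow> e = a * b" for e a b
    using t0 by (simp add: scale_eq_3)
  interpret grid5 "\<lambda>a b c d e. x + axis j (1 * a) + axis k (t * q * b) + axis l (t * q' * c) + axis m (t * q'' * d) + axis i (t * e) \<in> U"
    by (rule grid5_at) (use ne t0 f in simp_all)
  have "q * a * (t * q * b) = t * (a * b)" "q' * a * (t * q' * b) = t * (a * b)"
    "q'' * a * (t * q'' * b) = t * (a * b)" for a b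
    using sq by (metis (no_types, lifting) mult.assoc mult.commute mult_1)+
  note 1 = this
  have "p * (t * q * a) * (t * q' * b) = (q * q' * p) * (t * t) * (a * b)"
    "p' * (t * q * a) * (t * q'' * b) = (q * q'' * p') * (t * t) * (a * b)"
    "p'' * (t * q' * a) * (t * q'' * b) = (q' * q'' * p'') * (t * t) * (a * b)" for a b
    by (simp_all add: ac_simps)
  then have 2: "p * (t * q * a) * (t * q' * b) = t * (a * b)" "p' * (t * q * a) * (t * q'' * b) = t * (a * b)"
    "p'' * (t * q' * a) * (t * q'' * b) = t * (a * b)" for a b
    unfolding t sq by simp_all
  show False
    by (intro no_coherent_par_square)
      (simp_all add: hubD[OF hub] parD[OF d(1)] parD[OF d(2)] parD[OF d(3)] parD[OF d(4)] parD[OF d(5)] parD[OF d(6)] nz f t0 * 1 2)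
qed

text \<open>Reversed is relative to \<open>s\<close>, the sign with which \<open>j\<close>
  dominates: the slope is \<open>- s\<close> instead of \<open>s\<close>.\<close>

definition rev_line :: "3 \<Rightarrow> 'n \<Rightarrow> 3 ^ 'n \<Rightarrow> bool" where
  "rev_line s j y \<longleftrightarrow> (\<exists>r. \<forall>t. y + axis j t + axis i (r - s * t) \<in> U)"

lemma rev_line_shift: "rev_line s j (y + axis j t + axis i e) \<longleftrightarrow> rev_line s j y"
proof -
  have shift: "rev_line s j (y + axis j t + axis i e)" if rl: "rev_line s j y" for y t e
  proof -
    obtain r where r: "\<forall>t. y + axis j t + axis i (r - s * t) \<in> U"
      using rl unfolding rev_line_def by blast
    have "y + axis j t + axis i e + axis j t' + axis i (r - s * t - e - s * t') = y + axis j (t + t') + axis i (r - s * (t + t'))" for t'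
      by (simp add: axis_diff axis_add distrib_left)
    then show ?thesis
      unfolding rev_line_def by (metis r)
  qed
  have cancel: "y + axis j t + axis i e + axis j (- t) + axis i (- e) = y"
    by (simp add: vec_eq_iff axis_def)
  show ?thesis
    using shift[of y t e] shift[of "y + axis j t + axis i e" "- t" "- e", unfolded cancel] by blast
qed

text \<open>This is \<open>reversed_box\<close> around \<open>y\<close>: scaling \<open>j\<close> by
  \<open>s\<close> and shifting the colours by \<open>r\<close> turns the line into
  \<open>e = - t\<close>, while \<open>f\<close>, \<open>g\<close>, \<open>h\<close> fix which step
  is called 2.\<close>

lemma rev_line_corner:
  assumes ne: "j \<noteq> i" "k \<noteq> i" "l \<noteq> i" "m \<noteq> i" "k \<noteq> j" "l \<noteq> j" "m \<noteq> j" "k \<noteq> l" "k \<noteq> m" "l \<noteq> m"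
    and nz: "s \<noteq> 0" "f \<noteq> 0" "g \<noteq> 0" "h \<noteq> 0"
    and not_rev: "\<And>a b c. a = 2 \<or> b = 2 \<or> c = 2 \<Longrightarrow>
      \<not> rev_line s j (y + axis k (f * a) + axis l (g * b) + axis m (h * c))"
  shows "\<not> rev_line s j y"
proof
  assume "rev_line s j y"
  then obtain r where r: "\<forall>t. y + axis j t + axis i (r - s * t) \<in> U"
    unfolding rev_line_def by blast
  define u where "u = (\<lambda>a b c t e. y + axis i r + axis k (f * a) + axis l (g * b) + axis m (h * c) + axis j (s * t) + axis i (1 * e) \<in> U)"
  interpret grid5 u
    unfolding u_def by (rule grid5_at) (use ne nz in simp_all)
  have origin: "u 0 0 0 t (- t)" for t
    using r[rule_format, of "s * t"] nz by (simp add: u_def axis_diff axis_minus algebra_simps)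
  \<comment> \<open>A second colour \<open>e\<close> at position \<open>t\<close> would have one
    mate along the fibre and another at position \<open>- e\<close> of the line.\<close>
  have origin': "e = - t" if "u 0 0 0 t e" for t e
  proof (rule ccontr)
    assume "e \<noteq> - t"
    then have "- t \<noteq> - (- e)"
      by (metis minus_minus)
    then show False
      using cross(10)[of 0 0 0 t e "- e" "- t"] origin[of t] origin[of "- e"] that \<open>e \<noteq> - t\<close> by auto
  qed
  interpret reversed_box u
  proof
    show "\<forall>t e. u 0 0 0 t e \<longleftrightarrow> e = - t"
      using origin origin' by blast
    show "\<forall>a b c. a = 2 \<or> b = 2 \<or> c = 2 \<longrightarrow> \<not> reversed (u a b c)"
    proof (intro allI impI notI)
      fix a b c :: 3
      assume "a = 2 \<or> b = 2 \<or> c = 2" "reversed (u a b c)"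
      then obtain r' where "\<forall>t. u a b c t (r' - t)"
        unfolding reversed_def by blast
      then have "u a b c (s * t) (r' - s * t)" for t
        by blast
      then have 1: "y + axis i r + axis k (f * a) + axis l (g * b) + axis m (h * c) + axis j t + axis i (r' - s * t) \<in> U" for t
        using nz by (simp add: u_def)
      have 2: "y + axis i r + axis k (f * a) + axis l (g * b) + axis m (h * c) + axis j t + axis i (r' - s * t) =
        y + axis k (f * a) + axis l (g * b) + axis m (h * c) + axis j t + axis i (r + r' - s * t)" for t
        by (simp add: axis_diff axis_add algebra_simps)
      have "rev_line s j (y + axis k (f * a) + axis l (g * b) + axis m (h * c))"
        unfolding rev_line_def using 1[unfolded 2] by blast
      then show False
        using not_rev \<open>a = 2 \<or> b = 2 \<or> c = 2\<close> by blast
    qed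
  qed
  show False
    by (rule contradiction)
qed

text \<open>The case of distance two from the hub in the induction below. The relative order of
  \<open>j\<close>, \<open>k\<close>, \<open>l\<close> determines enough of the colours along the
  line to exclude the slope \<open>- s\<close>.\<close>

lemma no_rev_line_plane:
  assumes hub: "hub x {j, k, l}" and ne: "j \<noteq> i" "k \<noteq> i" "l \<noteq> i" "j \<noteq> k" "j \<noteq> l" "k \<noteq> l"
    and k: "dominates s x j k \<or> dominates r x k j" and l: "dominates s x j l \<or> dominates q x l j" and s: "s \<noteq> 0"
    and b: "b \<noteq> 0" and c: "c \<noteq> 0"
  shows "\<not> rev_line s j (x + axis k b + axis l c)"
proof
  assume "rev_line s j (x + axis k b + axis l c)"
  then obtain m where m: "\<forall>t. x + axis k b + axis l c + axis j t + axis i (m - s * t) \<in> U"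
    unfolding rev_line_def by blast
  have hub': "hub x {l, j, k}" "hub x {k, j, l}" "hub x {k, l}" "hub x {k, l, j}" "hub x {l, k, j}"
    using hub by (simp_all add: hub_def)
  note ne' = ne ne[symmetric]
  have not_affine: False if "\<And>t. m - s * t = n + s * t" for n
    using that[of 0] that[of 1] s cases_3[of s] by auto
  \<comment> \<open>With \<open>k'\<close> above \<open>j\<close> and \<open>j\<close> above
    \<open>l'\<close>, the excluded cycles and chains force \<open>k'\<close> above
    \<open>l'\<close>; then \<open>chain_colour\<close> gives the line slope
    \<open>s\<close>.\<close>
  have middle: False if d: "dominates p x k' j" "dominates s x j l'"
      and kl: "k' = k \<and> l' = l \<and> b' = b \<and> c' = c \<or> k' = l \<and> l' = k \<and> b' = c \<and> c' = b"
    for p k' l' b' c'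
  proof -
    have ne: "k' \<noteq> i" "l' \<noteq> i" "j \<noteq> k'" "j \<noteq> l'" "k' \<noteq> l'" "l' \<noteq> k'" "j \<noteq> i"
      using kl ne' by auto
    have hub: "hub x {k', l'}" "hub x {k', j, l'}"
      using kl hub' by (auto simp: insert_commute)
    have bc: "b' \<noteq> 0" "c' \<noteq> 0"
      using kl b c by auto
    have p: "x + axis k b + axis l c + axis j t + axis i e = x + axis k' b' + axis j t + axis l' c' + axis i e" for t e
      using kl by (auto simp: algebra_simps)
    obtain q where q: "dominates q x k' l'"
      using hub_cases[OF hub(1)] no_cycle[OF hub(2) _ _ _ _ _ _ d] no_chain_par[OF hub(2) _ _ _ _ _ _ d] ne by metis
    have "q = p"
      using dominance_sign[OF hub(2) _ _ _ _ _ _ d(1) q] ne by metis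
    have "m - s * t = p * b' + s * t" for t
    proof (cases "t = 0")
      case True
      then show ?thesis
        using m[rule_format, of 0, unfolded p] dominatesD[OF q bc] \<open>q = p\<close> by simp
    next
      case False
      then show ?thesis
        using m[rule_format, of t, unfolded p] chain_colour[OF hub(2) _ _ _ _ _ _ d(1) q d(2) bc(1) False bc(2)] ne
        by metis
    qed
    then show False
      using not_affine by blast
  qed
  \<comment> \<open>Here the colour is the same at \<open>t = 1\<close> and \<open>t = 2\<close>,
    whereas a reversed line takes distinct colours.\<close>
  have below: False if d: "dominates r x k' j" "dominates q x l' j" "dominates p x k' l'"
      and kl: "k' = k \<and> l' = l \<and> b' = b \<and> c' = c \<or> k' = l \<and> l' = k \<and> b' = c \<and> c' = b"
    for p q r k' l' b' c'
  proof -
    have ne: "k' \<noteq> i" "l' \<noteq> i" "k' \<noteq> j" "l' \<noteq> j" "k' \<noteq> l'" "l' \<noteq> k'" "j \<noteq> i"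
      using kl ne' by auto
    have hub: "hub x {k', l', j}"
      using kl hub' by auto
    have bc: "b' \<noteq> 0" "c' \<noteq> 0"
      using kl b c by auto
    have p: "x + axis k b + axis l c + axis j t + axis i e = x + axis k' b' + axis l' c' + axis j t + axis i e" for t e
      using kl by (auto simp: algebra_simps)
    have "m - s * t = p * b' + q * c'" if "t \<noteq> 0" for t
      using m[rule_format, of t, unfolded p] chain_colour[OF hub _ _ _ _ _ _ d(3,1,2) bc that] ne by metis
    from this[of 1] this[of 2] have "m - s * 1 = m - s * 2"
      by simp
    then show False
      using s scale_eq_3[of s 1 2] by simp
  qed
  consider "dominates s x j k" "dominates s x j l" | "dominates r x k j" "dominates s x j l" | "dominates q x l j" "dominates s x j k"
    | "dominates r x k j" "dominates q x l j"
    using k l by blast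
  then show False
  proof cases
    case 1
    \<comment> \<open>This \<open>t\<close> solves \<open>m - s * t = s * t\<close>. There the
      reversed line gives \<open>p\<close> a neighbour in direction \<open>l\<close>, besides its
      mate in direction \<open>k\<close>.\<close>
    define t where "t = 2 * s * m"
    have t: "m - s * t = s * t"
      using s cases_3[of s] cases_3[of m] by (auto simp: t_def add_3)
    define p where "p = x + axis k b + axis j t + axis i (s * t)"
    have bb: "b + b \<noteq> 0"
      using b cases_3[of b] by auto
    have p': "p + axis k b = x + axis k (b + b) + axis j t + axis i (s * t)"
      unfolding p_def axis_add by (simp only: ac_simps)
    have "x + axis k b' + axis j t + axis i (s * t) \<in> U" if "b' \<noteq> 0" for b'
    proof (cases "t = 0")
      case True
      then show ?thesis
        using hubD0[OF hub, of k b'] that by simp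
    next
      case False
      then show ?thesis
        using dominatesD'[OF 1(1) False that, of "s * t"] by simp
    qed
    from this[OF b] this[OF bb] have "p \<in> U" "p + axis k b \<in> U"
      by (simp_all only: p_def[symmetric] p')
    moreover have "p + axis l c = x + axis k b + axis l c + axis j t + axis i (s * t)"
      by (simp only: p_def ac_simps)
    then have "p + axis l c \<in> U"
      using m[rule_format, of t] by (simp only: t)
    ultimately show False
      using mates[of p k b l c] b c ne by blast
  next
    case 2
    then show False
      using middle by blast
  next
    case 3
    then show False
      using middle by blast
  next
    case 4
    obtain p where "dominates p x k l \<or> dominates p x l k"
      using hub_cases[OF hub'(3)] no_fork_par[OF hub'(2) _ _ _ _ _ _ 4] ne ne' by metis
    then show False
      using below[OF 4] below[OF 4(2,1)] by blast
  qed
qed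

text \<open>Induction on the Hamming distance to the hub, ignoring the directions \<open>i\<close>
  and \<open>j\<close>. Up to distance two the colours are known; from distance three on,
  \<open>rev_line_corner\<close> reduces the claim to points closer to the hub.\<close>

lemma no_rev_line:
  assumes hub: "hub x (- {i})" and j: "j \<noteq> i" and s: "s \<noteq> 0"
    and comparable: "\<And>k. k \<noteq> i \<Longrightarrow> k \<noteq> j \<Longrightarrow> dominates s x j k \<or> (\<exists>r. dominates r x k j)"
  shows "\<not> rev_line s j y"
proof (induction "card {k. k \<noteq> i \<and> k \<noteq> j \<and> y $ k \<noteq> x $ k}" arbitrary: y rule: less_induct)
  case less
  define K where "K = {k. k \<noteq> i \<and> k \<noteq> j \<and> y $ k \<noteq> x $ k}"
  define y' where "y' = y + axis j (x $ j - y $ j) + axis i (x $ i - y $ i)"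
  have y': "rev_line s j y \<longleftrightarrow> rev_line s j y'"
    unfolding y'_def rev_line_shift ..
  consider "K = {}" | k where "K = {k}" | k l where "K = {k, l}" "k \<noteq> l" | k l m where "{k, l, m} \<subseteq> K" "k \<noteq> l" "k \<noteq> m" "l \<noteq> m"
    by blast
  then show ?case
  proof cases
    case 1
    then have "y' = x"
      using j by (auto simp: K_def y'_def vec_eq_iff axis_def)
    have "\<not> rev_line s j x"
    proof
      assume "rev_line s j x"
      then obtain r where r: "\<forall>t. x + axis j t + axis i (r - s * t) \<in> U"
        unfolding rev_line_def by blast
      have "r - s * 1 = r - s * 2"
        using hubD[OF hub, of j 1 "r - s * 1"] hubD[OF hub, of j 2 "r - s * 2"] j r[rule_format, of 1] r[rule_format, of 2]
        by simp
      then show False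
        using s scale_eq_3[of s 1 2] by simp
    qed
    then show ?thesis
      unfolding y' \<open>y' = x\<close> .
  next
    case 2
    define b where "b = y $ k - x $ k"
    have k: "k \<noteq> i" "k \<noteq> j" "b \<noteq> 0"
      using 2 by (auto simp: K_def b_def)
    have y'_eq: "y' = x + axis k b"
      using 2 j k unfolding K_def set_eq_iff by (auto simp: y'_def b_def vec_eq_iff axis_def)
    have "\<not> rev_line s j (x + axis k b)"
    proof
      assume "rev_line s j (x + axis k b)"
      then obtain r where r: "\<forall>t. x + axis k b + axis j t + axis i (r - s * t) \<in> U"
        unfolding rev_line_def by blast
      show False
      proof (cases "dominates s x j k")
        case True
        have "r - s * 1 = s * 1" "r - s * 0 = 0"
          using r[rule_format, of 1] r[rule_format, of 0] dominatesD'[OF True, of 1 b "r - s * 1"] hubD[OF hub, of k b "r - s * 0"] k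
          by simp_all
        then show False
          using s cases_3[of s] by auto
      next
        case False
        then obtain q where "dominates q x k j"
          using comparable k by blast
        then have "r - s * 1 = r - s * 2"
          using r[rule_format, of 1] r[rule_format, of 2] dominatesD[of q x k j b 1 "r - s * 1"] dominatesD[of q x k j b 2 "r - s * 2"] k
          by simp
        then show False
          using s scale_eq_3[of s 1 2] by simp
      qed
    qed
    then show ?thesis
      unfolding y' y'_eq .
  next
    case 3
    define b c where "b = y $ k - x $ k" and "c = y $ l - x $ l"
    have kl: "k \<noteq> i" "k \<noteq> j" "b \<noteq> 0" "l \<noteq> i" "l \<noteq> j" "c \<noteq> 0"
      using 3 by (auto simp: K_def b_def c_def)
    have y'_eq: "y' = x + axis k b + axis l c"
      using 3 j kl unfolding K_def set_eq_iff by (auto simp: y'_def b_def c_def vec_eq_iff axis_def)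
    obtain r q where "dominates s x j k \<or> dominates r x k j" "dominates s x j l \<or> dominates q x l j"
      using comparable kl by blast
    then show ?thesis
      unfolding y' y'_eq using 3 kl j s
      by (intro no_rev_line_plane[of x j k l s r q b c] hub_mono[OF hub]) auto
  next
    case 4
    \<comment> \<open>With these steps the coordinate value 2 restores the coordinate of
      \<open>x\<close>, since \<open>y $ k + 2 * f = x $ k\<close>; the values 0 and 1 never
      increase the distance.\<close>
    define f g h where "f = y $ k - x $ k" and "g = y $ l - x $ l" and "h = y $ m - x $ m"
    have klm: "k \<noteq> i" "k \<noteq> j" "f \<noteq> 0" "l \<noteq> i" "l \<noteq> j" "g \<noteq> 0" "m \<noteq> i" "m \<noteq> j" "h \<noteq> 0"
      using 4 by (auto simp: K_def f_def g_def h_def)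
    show ?thesis
    proof (rule rev_line_corner[OF j klm(1,4,7,2,5,8) 4(2-4) s klm(3,6,9)])
      fix a b c :: 3
      define z where "z = y + axis k (f * a) + axis l (g * b) + axis m (h * c)"
      assume abc: "a = 2 \<or> b = 2 \<or> c = 2"
      have "{n. n \<noteq> i \<and> n \<noteq> j \<and> z $ n \<noteq> x $ n} \<subset> K"
      proof (rule psubsetI)
        have off: "z $ n = y $ n" if "n \<notin> {k, l, m}" for n
          using that by (auto simp: z_def axis_def)
        then show "{n. n \<noteq> i \<and> n \<noteq> j \<and> z $ n \<noteq> x $ n} \<subseteq> K"
          using 4(1) by (auto simp: K_def) (metis insert_iff empty_iff)+
        have "z $ k = x $ k \<or> z $ l = x $ l \<or> z $ m = x $ m"
          using abc 4 by (auto simp: z_def axis_def f_def g_def h_def add_3)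
        then show "{n. n \<noteq> i \<and> n \<noteq> j \<and> z $ n \<noteq> x $ n} \<noteq> K"
          using 4(1) by auto
      qed
      then show "\<not> rev_line s j (y + axis k (f * a) + axis l (g * b) + axis m (h * c))"
        unfolding z_def[symmetric] K_def by (intro less) (simp add: psubset_card_mono)
    qed
  qed
qed

section \<open>Directions comparable with all others\<close>

text \<open>The set \<open>D\<close> of the introduction.\<close>

definition double :: "(3 ^ 'n) set" where
  "double = {x. x \<notin> U \<and> x + axis i 1 \<in> U \<and> x + axis i 2 \<in> U}"

text \<open>The two points of \<open>U\<close> over \<open>x\<close> are mates, so no neighbour of
  \<open>x\<close> can share one of their colours.\<close>

lemma double_hub:
  assumes "x \<in> double"
  shows "hub x (- {i})"
  unfolding hub_def
proof (intro ballI allI impI)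
  fix j b e
  assume "j \<in> - {i}" and b: "b \<noteq> (0 :: 3)"
  then have j: "j \<noteq> i"
    by simp
  have U: "x + axis i e \<in> U" if "e \<noteq> 0" for e
    using that cases_3[of e] assms by (auto simp: double_def)
  have no: "x + axis j b + axis i e \<notin> U" if e: "e \<noteq> 0" for e
  proof
    assume "x + axis j b + axis i e \<in> U"
    then have "x + axis i e + axis j b \<in> U"
      by (simp only: ac_simps)
    moreover have "x + axis i e + axis i e = x + axis i (e + e)"
      by (simp only: axis_add add.assoc)
    moreover have "e + e \<noteq> 0"
      using e cases_3[of e] by auto
    ultimately show False
      using mates[of "x + axis i e" j b i e] U[OF e] U[of "e + e"] b e j by metis
  qed
  moreover obtain e' where "x + axis j b + axis i e' \<in> U"
    using fibre by blast
  ultimately have "x + axis j b + axis i 0 \<in> U"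
    by (cases "e' = 0") auto
  then show "x + axis j b + axis i e \<in> U \<longleftrightarrow> e = 0"
    using no by blast
qed

definition comparable :: "3 ^ 'n \<Rightarrow> 'n set" where
  "comparable x = {j. j \<noteq> i \<and> (\<forall>k q. k \<noteq> i \<longrightarrow> k \<noteq> j \<longrightarrow> \<not> par q x j k)}"

lemma comparableD:
  assumes "hub x (- {i})" "j \<in> comparable x" "k \<noteq> i" "k \<noteq> j"
  obtains s where "dominates s x j k" | s where "dominates s x k j"
proof (rule hub_cases)
  show "hub x {j, k}"
    using assms by (intro hub_mono[OF assms(1)]) (auto simp: comparable_def)
  show "par q x j k \<Longrightarrow> thesis" for q
    using assms(2-4) by (simp add: comparable_def)
qed (use assms that in \<open>auto simp: comparable_def\<close>)

lemma comparable_subset: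
  assumes x: "hub x (- {i})" and y: "y \<in> double"
  shows "comparable x \<subseteq> comparable y"
proof
  fix j
  assume j: "j \<in> comparable x"
  then have ji: "j \<noteq> i"
    by (simp add: comparable_def)
  \<comment> \<open>By \<open>dominance_sign\<close> the direction \<open>j\<close> dominates with a
    single sign; if it dominates nothing, 1 serves as a default.\<close>
  obtain s where s: "s \<noteq> 0" and sgn: "\<And>k. k \<noteq> i \<Longrightarrow> k \<noteq> j \<Longrightarrow> dominates s x j k \<or> (\<exists>r. dominates r x k j)"
  proof (cases "\<exists>s k. k \<noteq> i \<and> k \<noteq> j \<and> dominates s x j k")
    case True
    then obtain s k where k: "k \<noteq> i" "k \<noteq> j" "dominates s x j k"
      by blast
    have "dominates s x j l \<or> (\<exists>r. dominates r x l j)" if l: "l \<noteq> i" "l \<noteq> j" for l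
    proof (cases "l = k")
      case False
      have "hub x {j, k, l}"
        using x ji k l by (intro hub_mono[OF x]) auto
      then have "s = r" if "dominates r x j l" for r
        using dominance_sign[of x j k l s r] that k l ji False by auto
      then show ?thesis
        using comparableD[OF x j l] by metis
    qed (use k in blast)
    then show thesis
      using that[of s] dominates_nonzero[OF k(3)] by blast
  next
    case False
    then show thesis
      using that[of 1] comparableD[OF x j] by (metis one_neq_zero)
  qed
  have "\<not> par q y j k" if k: "k \<noteq> i" "k \<noteq> j" for k q
  proof
    assume p: "par q y j k"
    note q = par_nonzero[OF p]
    \<comment> \<open>Chosen with \<open>q * b = - s\<close>, so that the parallel pair produces a
      line of slope \<open>- s\<close> through \<open>y + axis k b\<close>.\<close>
    define b where "b = 2 * s * q"
    have b: "b \<noteq> 0"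
      using s q cases_3[of s] cases_3[of q] by (auto simp: b_def add_3)
    have "y + axis k b + axis j t + axis i (0 - s * t) \<in> U" for t
    proof (cases "t = 0")
      case True
      then show ?thesis
        using hubD0[OF double_hub[OF y], of k b] k b by simp
    next
      case False
      have "- (s * t) = q * t * b"
        using s q cases_3[of s] cases_3[of q] cases_3[of t] by (auto simp: b_def add_3 minus_3)
      then show ?thesis
        using parD[OF p False b, of "- (s * t)"] unfolding point_swap[of y k] by simp
    qed
    then have "rev_line s j (y + axis k b)"
      unfolding rev_line_def by blast
    then show False
      using no_rev_line[OF x ji s sgn] by blast
  qed
  then show "j \<in> comparable y"
    using ji by (simp add: comparable_def)
qed

text \<open>If \<open>k\<close> were parallel to \<open>l\<close>, then \<open>l\<close> above
  \<open>j\<close> would give a forbidden fork and \<open>j\<close> above \<open>l\<close> a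
  forbidden chain. The result supplies the closure condition on \<open>C\<close> in
  \<open>double_separated\<close>.\<close>

lemma comparable_initial:
  assumes x: "hub x (- {i})" and j: "j \<in> comparable x" and k: "k \<noteq> i" "dominates s x k j"
  shows "k \<in> comparable x"
  unfolding comparable_def
proof (intro CollectI conjI allI impI notI)
  fix l q
  assume l: "l \<noteq> i" "l \<noteq> k" and p: "par q x k l"
  have ji: "j \<noteq> i"
    using j by (simp add: comparable_def)
  have kj: "k \<noteq> j"
    using dominates_asym[OF k(2)] k(2) by blast
  have lj: "l \<noteq> j"
    using dominates_par[OF k(2)] p by blast
  have hub: "hub x {k, j, l}"
    using x ji k l by (intro hub_mono[OF x]) auto
  show False
  proof (rule comparableD[OF x j l(1) lj])
    show False if "dominates s x j l" for s
      by (rule no_chain_par[OF hub _ _ _ _ _ _ k(2) that p]) (use ji k(1) l kj lj in auto)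
    show False if "dominates s x l j" for s
      by (rule no_fork_par[OF hub _ _ _ _ _ _ k(2) that p]) (use ji k(1) l kj lj in auto)
  qed
qed (use k in auto)

text \<open>Induction on \<open>C\<close>: a topmost direction of \<open>C\<close> is removed by
  translating the hub along it until it agrees with \<open>y\<close> there. For empty
  \<open>C\<close>, distance one is impossible because a neighbour of a hub has one colour, and at
  distance two the hubs \<open>x\<close> and \<open>y\<close> give a common neighbour two
  mates.\<close>

lemma double_separated:
  assumes y: "y \<in> double" and hub: "hub x S" and S: "i \<notin> S" and supp: "{k. y $ k \<noteq> x $ k} \<subseteq> insert i S"
    and C: "C \<subseteq> S" "\<And>j k. j \<in> C \<Longrightarrow> k \<in> S \<Longrightarrow> k \<noteq> j \<Longrightarrow> (\<exists>s. dominates s x j k) \<or> k \<in> C \<and> (\<exists>s. dominates s x k j)"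
  shows "3 \<le> card {k \<in> S - C. y $ k \<noteq> x $ k} \<or> (\<forall>k\<in>S. y $ k = x $ k)"
  using assms(2-)
proof (induction "card C" arbitrary: x S C rule: less_induct)
  case (less C x S)
  have not_nbr: "y \<noteq> x + axis k b + axis i e" if "k \<in> S" "b \<noteq> 0" for k b e
  proof
    assume "y = x + axis k b + axis i e"
    then have "x + axis k b + axis i (e + 1) \<in> U" "x + axis k b + axis i (e + 2) \<in> U"
      using y by (simp_all add: double_def axis_add add.assoc)
    then have "e + 1 = 0" "e + 2 = 0"
      using hubD[OF less.prems(1) that] by blast+
    then show False
      using cases_3[of e] by auto
  qed
  show ?case
  proof (cases "C = {}")
    case True
    define T where "T = {k \<in> S. y $ k \<noteq> x $ k}"
    have "finite T"
      by simp
    consider "T = {}" | k where "T = {k}" | k l where "T = {k, l}" "k \<noteq> l" | "3 \<le> card T"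
    proof -
      have "card T = 0 \<or> card T = 1 \<or> card T = 2 \<or> 3 \<le> card T"
        by linarith
      then show thesis
        using that \<open>finite T\<close> by (auto simp: card_1_singleton_iff card_2_iff)
    qed
    then show ?thesis
    proof cases
      case 1
      then show ?thesis
        by (auto simp: T_def)
    next
      case 2
      have "y = x + axis k (y $ k - x $ k) + axis i (y $ i - x $ i)"
        using 2 less.prems(2,3) unfolding T_def set_eq_iff by (auto simp: vec_eq_iff axis_def)
      moreover have "k \<in> S" "y $ k - x $ k \<noteq> 0"
        using 2 by (auto simp: T_def)
      ultimately show ?thesis
        using not_nbr by blast
    next
      case 3
      define b c e where "b = y $ k - x $ k" and "c = y $ l - x $ l" and "e = y $ i - x $ i"
      have kl: "k \<in> S" "l \<in> S" "b \<noteq> 0" "c \<noteq> 0" "k \<noteq> i" "l \<noteq> i"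
        using 3 less.prems(2) by (auto simp: T_def b_def c_def)
      have y_eq: "y = x + axis k b + axis l c + axis i e"
        using 3 less.prems(2,3) kl unfolding T_def set_eq_iff by (auto simp: b_def c_def e_def vec_eq_iff axis_def)
      have "y + axis l (- c) = x + axis k b + axis i e"
        by (simp add: y_eq axis_minus)
      then have "x + axis k b + axis i e \<in> U"
        using hubD0[OF double_hub[OF y], of l "- c"] kl by simp
      then have "e = 0"
        using hubD[OF less.prems(1) kl(1,3)] by blast
      define p where "p = x + axis k b"
      have "p \<in> U"
        using hubD0[OF less.prems(1) kl(1,3)] by (simp add: p_def)
      moreover have "p + axis k b = x + axis k (b + b)" "b + b \<noteq> 0"
        using kl cases_3[of b] by (auto simp only: p_def axis_add add.assoc) (auto simp: add_3)
      then have "p + axis k b \<in> U"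
        using hubD0[OF less.prems(1) kl(1)] by simp
      moreover have "p + axis l (c + c) = y + axis l c"
        unfolding y_eq \<open>e = 0\<close> p_def axis_add axis_zero by (simp only: ac_simps add_0_right add_0_left)
      then have "p + axis l (c + c) \<in> U"
        using hubD0[OF double_hub[OF y], of l c] kl by simp
      ultimately show ?thesis
        using mates[of p k b l "c + c"] kl 3 cases_3[of c] by auto
    next
      case 4
      then show ?thesis
        using True by (simp add: T_def)
    qed
  next
    case False
    \<comment> \<open>A member of \<open>C\<close> with fewest dominators has none: dominance inside
      \<open>C\<close> is transitive since cycles are excluded. By the hypothesis on
      \<open>C\<close> it then dominates all of \<open>S\<close>.\<close>
    define pred where "pred = (\<lambda>j. {k \<in> C. \<exists>s. dominates s x k j})"
    have ni: "k \<noteq> i" if "k \<in> S" for k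
      using that less.prems(2) by blast
    obtain j where j: "j \<in> C" and minimal: "\<And>k. k \<in> C \<Longrightarrow> card (pred j) \<le> card (pred k)"
      using ex_has_least_nat[of "\<lambda>j. j \<in> C" _ "\<lambda>j. card (pred j)"] False by blast
    have "pred j = {}"
    proof (rule ccontr)
      assume "pred j \<noteq> {}"
      then obtain k t where k: "k \<in> C" "dominates t x k j"
        by (auto simp: pred_def)
      have "l \<in> pred j" if l: "l \<in> C" "dominates r x l k" for l r
      proof -
        have ne: "l \<noteq> j" "k \<noteq> j" "l \<noteq> k"
          using dominates_asym[OF k(2)] dominates_asym[OF l(2)] k(2) l(2) by blast+
        have hub: "hub x {l, k, j}"
          using j k l less.prems(4) by (intro hub_mono[OF less.prems(1)]) auto
        have "\<not> dominates q x j l" for q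
          using no_cycle[OF hub _ _ _ _ _ _ l(2) k(2)] ni j k(1) l(1) less.prems(4) ne by blast
        then show ?thesis
          using less.prems(4,5) j l ne unfolding pred_def by blast
      qed
      then have "pred k \<subseteq> pred j"
        by (auto simp: pred_def)
      moreover have "k \<in> pred j" "k \<notin> pred k"
        using k dominates_asym unfolding pred_def by blast+
      ultimately have "card (pred k) < card (pred j)"
        by (intro psubset_card_mono) auto
      then show False
        using minimal[OF k(1)] by simp
    qed
    then have top: "\<exists>s. dominates s x j k" if "k \<in> S" "k \<noteq> j" for k
      using less.prems(5)[OF j that] by (auto simp: pred_def)
    have jS: "j \<in> S" "j \<noteq> i"
      using j less.prems by auto
    obtain s where s: "\<And>k. k \<in> S \<Longrightarrow> k \<noteq> j \<Longrightarrow> dominates s x j k"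
    proof (cases "\<exists>k. k \<in> S \<and> k \<noteq> j")
      case True
      then obtain k s where k: "k \<in> S" "k \<noteq> j" "dominates s x j k"
        using top by blast
      have "dominates s x j l" if l: "l \<in> S" "l \<noteq> j" for l
      proof (cases "l = k")
        case False
        obtain r where r: "dominates r x j l"
          using top[OF l] by blast
        have "hub x {j, k, l}"
          using jS k l by (intro hub_mono[OF less.prems(1)]) auto
        then have "s = r"
          using dominance_sign[of x j k l s r] k l r False ni jS by auto
        then show ?thesis
          using r by simp
      qed (use k in simp)
      then show thesis
        using that by blast
    qed (use that in blast)
    define a where "a = y $ j - x $ j"
    \<comment> \<open>The colour shift \<open>s * a\<close> restores the normalisation: by
      dominance, the neighbours of \<open>x'\<close> in the directions \<open>S - {j}\<close> have
      colour 0 again.\<close>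
    define x' where "x' = x + axis j a + axis i (s * a)"
    have x': "x' + axis k b + axis i e = x + axis j a + axis k b + axis i (s * a + e)" for k b e
      by (simp only: x'_def axis_add ac_simps)
    have x'': "x' + axis k b + axis l c + axis i e = x + axis j a + axis k b + axis l c + axis i (s * a + e)" for k l b c e
      by (simp only: x'_def axis_add ac_simps)
    have hub': "hub x' (S - {j})"
      unfolding hub_def x'
    proof (intro ballI allI impI)
      fix k b e
      assume k: "k \<in> S - {j}" and b: "b \<noteq> (0 :: 3)"
      show "x + axis j a + axis k b + axis i (s * a + e) \<in> U \<longleftrightarrow> e = 0"
      proof (cases "a = 0")
        case True
        then show ?thesis
          using hubD[OF less.prems(1) _ b] k by simp
      next
        case False
        then show ?thesis
          using dominatesD[OF s False b, of k "s * a + e"] k by simp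
      qed
    qed
    have dominates': "dominates r x' k l" if kl: "k \<in> S - {j}" "l \<in> S - {j}" "k \<noteq> l" and d: "dominates r x k l" for r k l
      unfolding dominates_def x''
    proof (intro conjI allI impI)
      show "r \<noteq> 0"
        using dominates_nonzero[OF d] .
      fix b c e :: 3
      assume b: "b \<noteq> 0" and c: "c \<noteq> 0"
      show "x + axis j a + axis k b + axis l c + axis i (s * a + e) \<in> U \<longleftrightarrow> e = r * b"
      proof (cases "a = 0")
        case True
        then show ?thesis
          using dominatesD[OF d b c, of e] by simp
      next
        case False
        have "hub x {j, k, l}"
          using jS kl by (intro hub_mono[OF less.prems(1)]) auto
        then have "x + axis j a + axis k b + axis l c + axis i (s * a + e) \<in> U \<longleftrightarrow> s * a + e = s * a + r * b"
          by (rule chain_colour[OF _ _ _ _ _ _ _ s s d False b c]) (use jS kl ni in auto)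
        then show ?thesis
          by simp
      qed
    qed
    have eq: "y $ k \<noteq> x' $ k \<longleftrightarrow> y $ k \<noteq> x $ k" if "k \<noteq> i" "k \<noteq> j" for k
      using that by (simp add: x'_def axis_def)
    have eqj: "y $ j = x' $ j"
      using jS by (simp add: x'_def axis_def a_def)
    have "3 \<le> card {k \<in> (S - {j}) - (C - {j}). y $ k \<noteq> x' $ k} \<or> (\<forall>k\<in>S - {j}. y $ k = x' $ k)"
    proof (rule less.hyps[OF _ hub'])
      show "card (C - {j}) < card C"
        using j by (intro card_Diff1_less) auto
      show "{k. y $ k \<noteq> x' $ k} \<subseteq> insert i (S - {j})"
        using less.prems(3) eq eqj by auto
      fix k l
      assume "k \<in> C - {j}" "l \<in> S - {j}" "l \<noteq> k"
      then show "(\<exists>s. dominates s x' k l) \<or> l \<in> C - {j} \<and> (\<exists>s. dominates s x' l k)"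
        using less.prems(4,5) dominates' by blast
    qed (use less.prems in auto)
    then show ?thesis
    proof
      assume "3 \<le> card {k \<in> (S - {j}) - (C - {j}). y $ k \<noteq> x' $ k}"
      also have "{k \<in> (S - {j}) - (C - {j}). y $ k \<noteq> x' $ k} = {k \<in> S - C. y $ k \<noteq> x $ k}"
        using j eq ni by blast
      finally show ?thesis ..
    next
      assume agree: "\<forall>k\<in>S - {j}. y $ k = x' $ k"
      have "y = x + axis j a + axis i (y $ i - x $ i)"
        using agree less.prems(2,3) jS eq unfolding vec_eq_iff by (auto simp: axis_def a_def)
      then have "a = 0"
        using not_nbr[OF jS(1)] by blast
      then have "y $ j = x $ j"
        by (simp add: a_def)
      then have "\<forall>k\<in>S. y $ k = x $ k"
        using agree eq ni by blast
      then show ?thesis ..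
    qed
  qed
qed

section \<open>Bounding the number of incomparable directions\<close>

text \<open>The alternatives for \<open>k\<close> and \<open>l\<close> are the forbidden chain and
  the forbidden fork.\<close>

lemma par_dominated:
  assumes hub: "hub x {j, k, l}" and ne: "j \<noteq> i" "k \<noteq> i" "l \<noteq> i" "j \<noteq> l"
    and d: "dominates s x j k" and p: "par q x j l"
  obtains r where "par r x k l"
proof -
  have jk: "j \<noteq> k"
    using dominates_asym[OF d] d by blast
  have kl: "k \<noteq> l"
    using dominates_par[OF d] p by blast
  show thesis
  proof (rule hub_cases[of x k l])
    show "hub x {k, l}"
      using hub by (rule hub_mono) auto
    show thesis if "dominates r x k l" for r
      using no_chain_par[OF hub ne(1-3) jk ne(4) kl d that p] ..
    show thesis if "dominates r x l k" for r
      using no_fork_par[OF hub ne(1-3) jk ne(4) kl d that p] ..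
  qed (use that ne kl in auto)
qed

text \<open>The point \<open>v\<close> of the plane spanned by \<open>j\<close> and \<open>l\<close>
  would have mates in both dominated directions.\<close>

lemma single_child:
  assumes hub: "hub x {j, k, k', l}" and ne: "j \<noteq> i" "k \<noteq> i" "k' \<noteq> i" "l \<noteq> i" "j \<noteq> l" "k \<noteq> k'"
    and d: "dominates s x j k" "dominates s' x j k'" and p: "par q x j l"
  shows False
proof -
  have ne': "j \<noteq> k" "j \<noteq> k'" "k \<noteq> l" "k' \<noteq> l"
    using d dominates_asym dominates_par p by blast+
  have hub': "hub x {j, k, l}" "hub x {j, k', l}" "hub x {j, k, k'}"
    using hub by (auto intro: hub_mono)
  have "s' = s"
    using dominance_sign[OF hub'(3) _ _ _ _ _ _ d] ne ne' by auto
  obtain r r' where r: "par r x k l" "par r' x k' l"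
    using par_dominated[OF hub'(1) _ _ _ _ d(1) p] par_dominated[OF hub'(2) _ _ _ _ d(2) p] ne by metis
  define v where "v = x + axis j 1 + axis l (2 * s * q) + axis i (2 * s * 1)"
  have nz: "s \<noteq> 0" "q \<noteq> 0"
    using dominates_nonzero[OF d(1)] par_nonzero[OF p] by auto
  have "q * 1 * (2 * s * q) = 2 * s * 1"
    using nz cases_3[of q] cases_3[of s] by (auto simp: add_3)
  then have "v \<in> U"
    using parD[OF p, of 1 "2 * s * q" "2 * s * 1"] nz cases_3[of q] cases_3[of s] by (auto simp: v_def add_3)
  have v: "x + axis j 1 + axis m b + axis l (2 * s * q) + axis i (2 * s * 1) = v + axis m b" for m b
    by (simp only: v_def ac_simps)
  obtain b where "b \<noteq> 0" "v + axis k b \<in> U"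
    using dominance_par_mates[OF hub'(1) _ _ _ _ _ _ d(1) p r(1), of 1] ne ne' unfolding v by auto
  moreover obtain b' where "b' \<noteq> 0" "v + axis k' b' \<in> U"
    using dominance_par_mates[OF hub'(2) _ _ _ _ _ _ d(2) p r(2), of 1] ne ne' unfolding \<open>s' = s\<close> v by auto
  ultimately show False
    using mates[OF \<open>v \<in> U\<close>] ne(6) by blast
qed

lemma no_parallel_dominance:
  assumes hub: "hub x {j, k, l, m}" and ne: "j \<noteq> i" "k \<noteq> i" "l \<noteq> i" "m \<noteq> i" "j \<noteq> l"
    and d: "dominates s x j k" "dominates r x l m" and p: "par q x j l"
  shows False
proof -
  have ne': "j \<noteq> k" "l \<noteq> m" "k \<noteq> l" "j \<noteq> m"
    using d dominates_asym dominates_par dominates_par' p by blast+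
  have hub': "hub x {j, k, l}" "hub x {l, m, j}"
    using hub by (auto intro: hub_mono)
  have p': "par q x l j"
    using p par_commute by blast
  obtain t t' where t: "par t x k l" "par t' x m j"
    using par_dominated[OF hub'(1) _ _ _ _ d(1) p] par_dominated[OF hub'(2) _ _ _ _ d(2) p'] ne by metis
  have "k \<noteq> m"
    using t d(2) par_commute dominates_par by blast
  have nz: "s \<noteq> 0" "q \<noteq> 0" "r \<noteq> 0"
    using d[THEN dominates_nonzero] par_nonzero[OF p] by auto
  \<comment> \<open>The values for which \<open>dominance_par_mates\<close> applies to both
    dominances at the same point \<open>v\<close>, which then has mates along \<open>k\<close> and
    along \<open>m\<close>.\<close>
  define a c e where "a = 2 * r * q" and "c = 2 * s * q" and "e = r * s * q"
  have ac: "a \<noteq> 0" "c \<noteq> 0"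
    using nz cases_3[of r] cases_3[of s] cases_3[of q] by (auto simp: a_def c_def add_3)
  have e: "2 * s * a = e" "2 * r * c = e" "q * a * c = e"
    using nz cases_3[of r] cases_3[of s] cases_3[of q] by (auto simp: a_def c_def e_def add_3)
  define v where "v = x + axis j a + axis l c + axis i e"
  have "v \<in> U"
    using parD[OF p ac, of e] e by (simp add: v_def)
  have v: "x + axis j a + axis k b + axis l c + axis i e = v + axis k b"
    "x + axis l c + axis m b + axis j a + axis i e = v + axis m b" for b
    by (simp_all only: v_def ac_simps)
  obtain b where "b \<noteq> 0" "v + axis k b \<in> U"
    using dominance_par_mates[OF hub'(1) _ _ _ _ _ _ d(1) p t(1) ac(1)] ne ne' e v(1) unfolding c_def by auto
  moreover obtain b' where "b' \<noteq> 0" "v + axis m b' \<in> U"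
    using dominance_par_mates[OF hub'(2) _ _ _ _ _ _ d(2) p' t(2) ac(2)] ne ne' e v(2) unfolding a_def by auto
  ultimately show False
    using mates[OF \<open>v \<in> U\<close>] \<open>k \<noteq> m\<close> by blast
qed

text \<open>An incomparable direction dominates at most one other, so all further incomparable
  directions turn out to be parallel to both \<open>j\<close> and \<open>k\<close>; their signs
  leave room for two of them.\<close>

lemma card_incomparable_dom:
  assumes hub: "hub x (- {i})" and N: "N = - {i} - comparable x"
    and jk: "j \<in> N" "k \<in> N" "dominates s x j k"
  shows "card N \<le> 4"
proof -
  have sub: "hub x S" if "i \<notin> S" for S
    using that by (intro hub_mono[OF hub]) auto
  have partner: "\<exists>l q. l \<noteq> i \<and> l \<noteq> m \<and> par q x m l" if "m \<in> N" for m
    using that by (auto simp: N comparable_def)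
  have iN: "i \<notin> N"
    by (simp add: N)
  then have ni: "m \<noteq> i" if "m \<in> N" for m
    using that by blast
  have child: "m = m'" if c: "l \<in> N" "dominates t x l m" "dominates t' x l m'" "m \<noteq> i" "m' \<noteq> i" for l m m' t t'
  proof (rule ccontr)
    assume "m \<noteq> m'"
    obtain n q where n: "n \<noteq> i" "n \<noteq> l" "par q x l n"
      using partner[OF c(1)] by blast
    show False
      by (rule single_child[OF sub _ _ _ _ _ _ c(2,3) n(3)]) (use c iN n \<open>m \<noteq> m'\<close> in auto)
  qed
  have ne: "j \<noteq> k"
    using dominates_asym[OF jk(3)] jk(3) by blast
  have other: "\<exists>q r. par q x j m \<and> par r x k m" if m: "m \<in> N" "m \<noteq> j" "m \<noteq> k" for m
  proof -
    have jm: "\<exists>q. par q x j m"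
    proof (rule hub_cases[of x j m])
      show "\<exists>q. par q x j m" if "dominates t x j m" for t
        using child[OF jk(1) that jk(3)] ni m jk by blast
      show "\<exists>q. par q x j m" if t: "dominates t x m j" for t
      proof (rule ccontr)
        note hub' = sub[of "{m, j, k}"]
        have mk: "\<not> dominates t' x m k" for t'
          using child[OF m(1) t] ni m jk ne by blast
        show False
        proof (rule hub_cases[of x m k])
          show False if "dominates t' x k m" for t'
            by (rule no_cycle[OF hub' _ _ _ _ _ _ t jk(3) that]) (use iN m jk ne in auto)
          show False if "par t' x m k" for t'
            by (rule no_chain_par[OF hub' _ _ _ _ _ _ t jk(3) that]) (use iN m jk ne in auto)
        qed (use mk iN m jk in \<open>auto intro: sub\<close>)
      qed
    qed (use iN m jk in \<open>auto intro: sub\<close>)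
    then obtain q where q: "par q x j m"
      by blast
    obtain r where "par r x k m"
      by (rule par_dominated[OF sub _ _ _ _ jk(3) q]) (use iN m jk in auto)
    with q show ?thesis
      by blast
  qed
  \<comment> \<open>Equal products for two directions are excluded by
    \<open>no_dominance_par_square\<close>, and only the values 1 and 2 are possible.\<close>
  define f where "f = (\<lambda>m. (SOME q. par q x j m) * (SOME r. par r x k m))"
  have f: "\<exists>q r. par q x j m \<and> par r x k m \<and> f m = q * r" if m: "m \<in> N - {j, k}" for m
  proof -
    obtain q r where "par q x j m" "par r x k m"
      using other[of m] m by blast
    then have "par (SOME q. par q x j m) x j m" "par (SOME r. par r x k m) x k m"
      by (metis someI)+
    then show ?thesis
      unfolding f_def by blast
  qed
  have "inj_on f (N - {j, k})"
  proof (rule inj_onI, rule ccontr)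
    fix m n
    assume m: "m \<in> N - {j, k}" and n: "n \<in> N - {j, k}" and eq: "f m = f n" and mn: "m \<noteq> n"
    obtain q r where qr: "par q x j m" "par r x k m" "f m = q * r"
      using f[OF m] by blast
    obtain q' r' where qr': "par q' x j n" "par r' x k n" "f n = q' * r'"
      using f[OF n] by blast
    have no_dom: "\<not> dominates t x m n" "\<not> dominates t x n m" for t
      using no_parallel_dominance[OF sub _ _ _ _ _ jk(3) _ qr(1), of n t]
        no_parallel_dominance[OF sub _ _ _ _ _ jk(3) _ qr'(1), of m t] iN m n jk(1,2) by auto
    obtain p where p: "par p x m n"
      by (rule hub_cases[of x m n]) (use no_dom iN m n mn in \<open>auto intro: sub\<close>)
    have "q * r \<noteq> q' * r'"
      by (rule no_dominance_par_square[OF sub _ _ _ _ _ _ _ _ _ _ jk(3) qr(1) qr'(1) qr(2) qr'(2) p])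
        (use iN m n jk(1,2) mn ne in auto)
    then show False
      using eq qr(3) qr'(3) by simp
  qed
  moreover have "f ` (N - {j, k}) \<subseteq> {1, 2}"
  proof
    fix y
    assume "y \<in> f ` (N - {j, k})"
    then obtain m q r where "par q x j m" "par r x k m" "y = q * r"
      using f by blast
    then show "y \<in> {1, 2}"
      using par_nonzero cases_3[of y] by auto
  qed
  ultimately have "card (N - {j, k}) \<le> card {1, 2 :: 3}"
    by (intro card_inj_on_le[of f]) auto
  also have "\<dots> = 2"
    by simp
  also have "card (N - {j, k}) = card N - 2"
    using jk ne by (simp add: card_Diff_subset)
  finally show ?thesis
    by linarith
qed

text \<open>Given seven directions, fix \<open>v\<close> and colour each pair of the others by the
  sign \<open>g\<close> of its triangle with \<open>v\<close>. A monochromatic triangle among the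
  other six completes \<open>v\<close> to a coherent quadruple.\<close>

lemma card_par_clique:
  assumes hub: "hub x N" and N: "i \<notin> N"
    and par: "\<And>k l. k \<in> N \<Longrightarrow> l \<in> N \<Longrightarrow> k \<noteq> l \<Longrightarrow> \<exists>q. par q x k l"
  shows "card N \<le> 6"
proof (rule ccontr)
  assume "\<not> card N \<le> 6"
  then have "N \<noteq> {}"
    by auto
  then obtain v where v: "v \<in> N"
    by blast
  define q where "q = (\<lambda>k l. SOME q. par q x k l)"
  have q: "par (q k l) x k l" if "k \<in> N" "l \<in> N" "k \<noteq> l" for k l
    using par[OF that] unfolding q_def by (rule someI_ex)
  have q_sym: "q k l = q l k" for k l
    unfolding q_def using par_commute by metis
  define g where "g = (\<lambda>k l. q v k * q v l * q k l)"
  have nz: "q k l \<noteq> 0" if "k \<in> N" "l \<in> N" "k \<noteq> l" for k l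
    using par_nonzero[OF q[OF that]] .
  have "6 \<le> card (N - {v})"
    using v \<open>\<not> card N \<le> 6\<close> by simp
  moreover have "g k l = 1 \<longleftrightarrow> g l k = 1" for k l
    unfolding g_def using q_sym[of k l] by (simp add: ac_simps)
  ultimately obtain k l m where klm: "{k, l, m} \<subseteq> N - {v}" "k \<noteq> l" "k \<noteq> m" "l \<noteq> m"
    "(g k l = 1) = (g k m = 1)" "(g k l = 1) = (g l m = 1)"
    by (rule monochromatic_triangle[of "N - {v}" "\<lambda>k l. g k l = 1"])
  have "g k l \<noteq> 0" "g k m \<noteq> 0" "g l m \<noteq> 0"
    using nz v klm by (auto simp: g_def)
  then have eq: "g k m = g k l" "g l m = g k l"
    using klm cases_3[of "g k l"] cases_3[of "g k m"] cases_3[of "g l m"] by auto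
  have "hub x {v, k, l, m}"
    using hub v klm by (auto intro: hub_mono)
  then show False
    by (rule no_coherent_par_square[where q = "q v k" and q' = "q v l" and q'' = "q v m"
          and p = "q k l" and p' = "q k m" and p'' = "q l m" and t = "g k l"])
      (use v klm N q eq in \<open>auto simp: g_def\<close>)
qed

lemma card_incomparable:
  assumes hub: "hub x (- {i})"
  shows "card (- {i} - comparable x) \<le> 6"
proof (cases "\<exists>j k s. j \<in> - {i} - comparable x \<and> k \<in> - {i} - comparable x \<and> dominates s x j k")
  case True
  then show ?thesis
    using card_incomparable_dom[OF hub refl] by fastforce
next
  case False
  show ?thesis
  proof (rule card_par_clique)
    show "hub x (- {i} - comparable x)"
      using hub by (rule hub_mono) auto
    fix k l
    assume kl: "k \<in> - {i} - comparable x" "l \<in> - {i} - comparable x" "k \<noteq> l"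
    have "hub x {k, l}"
      using kl by (intro hub_mono[OF hub]) auto
    then show "\<exists>q. par q x k l"
      by (rule hub_cases) (use kl False in auto)
  qed auto
qed

section \<open>Counting\<close>

lemma card_eq: "card U = 3 ^ (CARD('n) - 1) + card double"
proof -
  have "card {e. y + axis i e \<in> U} = 1 + card {e. y + axis i e \<in> double}" for y
  proof -
    have "{e. y + axis i e \<in> U} \<noteq> {}"
      using fibre by blast
    moreover have "{e. y + axis i e \<in> U} \<noteq> UNIV"
    proof
      assume "{e. y + axis i e \<in> U} = UNIV"
      then have all: "y + axis i e \<in> U" for e
        by blast
      show False
        using lineI[OF all[of 0] all[of 1] all[of 2], of i 1 1 0 2] by simp
    qed
    moreover have "y + axis i e \<in> double \<longleftrightarrow> y + axis i e \<notin> U \<and> y + axis i (e + 1) \<in> U \<and> y + axis i (e + 2) \<in> U" for e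
      by (simp add: double_def axis_add add.assoc)
    ultimately show ?thesis
      using card_fibre[of "{e. y + axis i e \<in> U}"] by simp
  qed
  then have "card U = (\<Sum>y | y $ i = 0. 1 + card {e. y + axis i e \<in> double})"
    by (simp add: card_fibres[of U i])
  also have "\<dots> = card {y :: 3 ^ 'n. y $ i = 0} + card double"
    unfolding sum.distrib card_fibres[of double i] by simp
  finally show ?thesis
    unfolding card_hyperplane .
qed

text \<open>Apply \<open>double_separated\<close> with all directions but \<open>i\<close>. Its
  other alternative puts \<open>y\<close> on the line of \<open>x\<close> in direction
  \<open>i\<close>, whose remaining points lie in \<open>U\<close>.\<close>

lemma double_distance:
  assumes x: "x \<in> double" and y: "y \<in> double" and "x \<noteq> y"
  shows "3 \<le> card {k \<in> - {i} - comparable x. y $ k \<noteq> x $ k}"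
proof -
  have "\<exists>k\<in>- {i}. y $ k \<noteq> x $ k"
  proof (rule ccontr)
    assume "\<not> (\<exists>k\<in>- {i}. y $ k \<noteq> x $ k)"
    then have y_eq: "y = x + axis i (y $ i - x $ i)"
      by (auto simp: vec_eq_iff axis_def)
    moreover have "y $ i - x $ i \<noteq> 0"
      using y_eq \<open>x \<noteq> y\<close> by auto
    then have "x + axis i (y $ i - x $ i) \<in> U"
      using x cases_3[of "y $ i - x $ i"] by (auto simp: double_def)
    ultimately show False
      using y by (simp add: double_def)
  qed
  moreover have "(\<exists>s. dominates s x j k) \<or> k \<in> comparable x \<and> (\<exists>s. dominates s x k j)"
    if "j \<in> comparable x" "k \<in> - {i}" "k \<noteq> j" for j k
    by (rule comparableD[OF double_hub[OF x] that(1), of k])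
      (use that comparable_initial[OF double_hub[OF x]] in auto)
  ultimately show ?thesis
    using double_separated[OF y double_hub[OF x], of "comparable x"] by (auto simp: comparable_def)
qed

lemma card_double: "card double \<le> 81"
proof (cases "double = {}")
  case False
  then obtain x where x: "x \<in> double"
    by blast
  define N where "N = - {i} - comparable x"
  have N: "N = - {i} - comparable y" if "y \<in> double" for y
    unfolding N_def using comparable_subset double_hub x that by blast
  have dist: "3 \<le> card {k \<in> N. z $ k \<noteq> y $ k}" if "y \<in> double" "z \<in> double" "y \<noteq> z" for y z
    unfolding N[OF that(1)] by (rule double_distance[OF that])
  have "card N \<le> 6"
    unfolding N_def by (rule card_incomparable[OF double_hub[OF x]])
  \<comment> \<open>The coordinates kept in the Singleton bound; at most two directions of
    \<open>N\<close> are deleted, and none if \<open>N\<close> has at most four.\<close>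
  obtain T where T: "T \<subseteq> N" "card T = min 4 (card N)"
    using obtain_subset_with_card_n[of "min 4 (card N)" N] by auto
  have rest: "card (N - T) \<le> 2"
    using T \<open>card N \<le> 6\<close> by (simp add: card_Diff_subset)
  have "inj_on (\<lambda>y. restrict (($) y) T) double"
  proof (rule inj_onI, rule ccontr)
    fix y z
    assume y: "y \<in> double" and z: "z \<in> double" and eq: "restrict (($) y) T = restrict (($) z) T" and "y \<noteq> z"
    have "y $ k = z $ k" if "k \<in> T" for k
      using fun_cong[OF eq, of k] that by simp
    then have "{k \<in> N. z $ k \<noteq> y $ k} \<subseteq> N - T"
      by auto
    then have "card {k \<in> N. z $ k \<noteq> y $ k} \<le> card (N - T)"
      by (intro card_mono) auto
    then show False
      using dist[OF y z \<open>y \<noteq> z\<close>] rest by linarith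
  qed
  then have "card double \<le> card (T \<rightarrow>\<^sub>E (UNIV :: 3 set))"
    by (rule card_inj_on_le) (auto simp: finite_PiE)
  also have "\<dots> = 3 ^ card T"
    by (simp add: card_PiE)
  also have "\<dots> \<le> 3 ^ 4"
    using T by (intro power_increasing) auto
  finally show ?thesis
    by simp
qed simp

end

section \<open>From the induced subgraph to the mate condition\<close>

lemma configurationI:
  fixes U :: "(3 ^ 'n::finite) set"
  assumes sat: "saturated i U" and deg: "max_degree (with_proj hamming_graph3 \<restriction> U) \<le> 1"
  shows "configuration U i"
proof
  fix x :: "3 ^ 'n"
  have "2 *s axis i (1 :: 3) = (axis i 2 :: 3 ^ 'n)"
    by (simp add: vec_eq_iff axis_def)
  then have "x \<in> U \<or> x + axis i 1 \<in> U \<or> x + axis i 2 \<in> U"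
    using sat unfolding saturated_def by fastforce
  then show "\<exists>e. x + axis i e \<in> U"
    unfolding ex_3 by simp
next
  fix x :: "3 ^ 'n" and j k a b
  assume x: "x \<in> U" and y: "x + axis j a \<in> U" and z: "x + axis k b \<in> U" and nz: "a \<noteq> 0" "b \<noteq> 0"
  define G where "G = with_proj (hamming_graph3 :: (3 ^ 'n) pair_pre_digraph) \<restriction> U"
  have "verts G = U"
    by (simp add: G_def)
  then have "out_degree G x \<le> Max (out_degree G ` verts G)"
    using x by (intro Max_ge) auto
  then have "card (out_arcs G x) \<le> 1"
    using deg by (simp add: max_degree_def G_def out_degree_def)
  \<comment> \<open>A nonzero step along one axis changes exactly one coordinate, so every mate of
    \<open>x\<close> is the head of an arc leaving \<open>x\<close>.\<close>
  moreover have arc: "(x, x + axis l c) \<in> out_arcs G x" if "x + axis l c \<in> U" "c \<noteq> 0" for l c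
  proof -
    have "\<exists>!m. x $ m \<noteq> (x + axis l c) $ m"
      using that(2) by (intro ex1I[of _ l]) (auto simp: axis_def split: if_splits)
    then show ?thesis
      using x that(1) by (simp add: G_def induce_subgraph_def hamming_graph3_def)
  qed
  moreover have "finite (out_arcs G x)"
    by (rule finite_subset[OF subset_UNIV]) simp
  ultimately have "(x, x + axis j a) = (x, x + axis k b)"
    using arc[OF y nz(1)] arc[OF z nz(2)] by (metis card_le_Suc0_iff_eq One_nat_def)
  then have "axis j a $ j = axis k b $ j"
    by simp
  then show "j = k \<and> a = b"
    using nz by (auto simp: axis_def split: if_splits)
qed

theorem theorem1p5:
  fixes U :: "(3 ^ 'n::finite) set" and i :: 'n
  assumes "saturated i U"
    and "max_degree (with_proj hamming_graph3 \<restriction> U) \<le> 1"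
  shows "card U \<le> 3 ^ (CARD('n) - 1) + 81"
proof -
  interpret configuration U i
    using assms by (rule configurationI)
  show ?thesis
    using card_eq card_double by simp
qed

end
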